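(* Let $\mathscr{C}$ be a closed oligomorphic core clone (on an at most countable domain) which satisfies a non-trivial set of h1 identities. Then $\mathscr{C}$ satisfies $pL^2_4$.
   Context: A function clone $\mathscr{C}$ on a set $C$ is a set of operations on $C$ of finite arity $\ge 1$ containing all projections and closed under composition. $\operatorname{Gr}(\mathscr{C})$ is the group of all unary bijections in $\mathscr{C}$ whose inverse is also in $\mathscr{C}$. $\mathscr{C}$ is oligomorphic if $\operatorname{Gr}(\mathscr{C})$ has finitely many orbits in its componentwise action on $C^k$ for every $k\ge 1$. $\mathscr{C}$ is closed if it is topologically closed in the set of all finitary operations on $C$ with the topology of pointwise convergence ($C$ discrete). $\mathscr{C}$ is a core if $\operatorname{Gr}(\mathscr{C})$ is dense (pointwise topology) in the unary functions of $\mathscr{C}$. An h1 (height 1) identity over a functional signature $\Omega$ is an identity $f(x_1,\dots,x_n)\approx g(y_1,\dots,y_k)$ where $f,g\in\Omega$ are function symbols and the $x_i,y_j$ are not necessarily distinct variables. A set of identities over $\Omega$ is satisfied in $\mathscr{C}$ if the symbols of $\Omega$ can be assigned functions of $\mathscr{C}$ so that all equations hold for all values of the variables in $C$. It is non-trivial if it is not satisfied by the clone of all projections on an at least two-element set. $pL^2_4$ is the pseudo-loop condition $u_1\circ f(r_{1,1},\ldots,r_{1,12})\approx u_2\circ f(r_{2,1},\ldots,r_{2,12})$, where $f$ is a $12$-ary and $u_1,u_2$ are unary function symbols, and $(r_{1,i},r_{2,i})$, $1\le i\le 12$, enumerates all pairs of distinct elements of $\{1,2,3,4\}$, regarded as variables.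 *)

theory Defs
  imports "HOL-Analysis.Analysis"
begin

text \<open>An \<open>n\<close>-tuple over \<open>C\<close> is an extensional function on \<open>{..<n}\<close>, so coordinates are
  numbered from 0. A finitary operation is tagged with its arity, which is at least 1.\<close>

definition tuples :: "nat \<Rightarrow> 'a set \<Rightarrow> (nat \<Rightarrow> 'a) set"
  where "tuples n C = {..<n} \<rightarrow>\<^sub>E C"

type_synonym 'a operation = "(nat \<Rightarrow> 'a) \<Rightarrow> 'a"

definition operations :: "'a set \<Rightarrow> (nat \<times> 'a operation) set"
  where "operations C = (SIGMA n:{1..}. tuples n C \<rightarrow>\<^sub>E C)"

definition projection :: "'a set \<Rightarrow> nat \<Rightarrow> nat \<Rightarrow> 'a operation"
  where "projection C n i = (\<lambda>x\<in>tuples n C. x i)"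

definition compose_op ::
    "'a set \<Rightarrow> nat \<Rightarrow> nat \<Rightarrow> 'a operation \<Rightarrow> (nat \<Rightarrow> 'a operation) \<Rightarrow> 'a operation"
  where "compose_op C n m f g = (\<lambda>x\<in>tuples m C. f (\<lambda>i\<in>{..<n}. g i x))"

definition function_clone :: "'a set \<Rightarrow> (nat \<times> 'a operation) set \<Rightarrow> bool"
  where "function_clone C \<C> \<longleftrightarrow>
    \<C> \<subseteq> operations C \<and>
    (\<forall>n i. i < n \<longrightarrow> (n, projection C n i) \<in> \<C>) \<and>
    (\<forall>n m f g. (n, f) \<in> \<C> \<and> (\<forall>i<n. (m, g i) \<in> \<C>) \<longrightarrow> (m, compose_op C n m f g) \<in> \<C>)"

definition projection_clone :: "'a set \<Rightarrow> (nat \<times> 'a operation) set"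
  where "projection_clone C = {(n, projection C n i) | n i. i < n}"

definition pointwise_topology :: "'i set \<Rightarrow> 'a set \<Rightarrow> ('i \<Rightarrow> 'a) topology"
  where "pointwise_topology X C = product_topology (\<lambda>_. discrete_topology C) X"

definition operations_topology :: "'a set \<Rightarrow> (nat \<times> 'a operation) topology"
  where "operations_topology C = sum_topology (\<lambda>n. pointwise_topology (tuples n C) C) {1..}"

definition closed_clone :: "'a set \<Rightarrow> (nat \<times> 'a operation) set \<Rightarrow> bool"
  where "closed_clone C \<C> \<longleftrightarrow> closedin (operations_topology C) \<C>"

text \<open>Unary members of a clone are also regarded as extensional functions from \<open>C\<close> to \<open>C\<close>;
  \<open>unary_op\<close> is the passage from such a function to the operation on 1-tuples.\<close>

definition unary_op :: "'a set \<Rightarrow> ('a \<Rightarrow> 'a) \<Rightarrow> 'a operation"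
  where "unary_op C u = (\<lambda>x\<in>tuples 1 C. u (x 0))"

definition unary_part :: "'a set \<Rightarrow> (nat \<times> 'a operation) set \<Rightarrow> ('a \<Rightarrow> 'a) set"
  where "unary_part C \<C> = {u \<in> C \<rightarrow>\<^sub>E C. (1, unary_op C u) \<in> \<C>}"

definition Gr :: "'a set \<Rightarrow> (nat \<times> 'a operation) set \<Rightarrow> ('a \<Rightarrow> 'a) set"
  where "Gr C \<C> = {u \<in> unary_part C \<C>.
    bij_betw u C C \<and> restrict (inv_into C u) C \<in> unary_part C \<C>}"

definition orbit_of_tuple :: "('a \<Rightarrow> 'a) set \<Rightarrow> nat \<Rightarrow> (nat \<Rightarrow> 'a) \<Rightarrow> (nat \<Rightarrow> 'a) set"
  where "orbit_of_tuple G k x = {\<lambda>i\<in>{..<k}. u (x i) | u. u \<in> G}"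

definition oligomorphic :: "'a set \<Rightarrow> (nat \<times> 'a operation) set \<Rightarrow> bool"
  where "oligomorphic C \<C> \<longleftrightarrow> (\<forall>k\<ge>1. finite (orbit_of_tuple (Gr C \<C>) k ` tuples k C))"

definition core_clone :: "'a set \<Rightarrow> (nat \<times> 'a operation) set \<Rightarrow> bool"
  where "core_clone C \<C> \<longleftrightarrow>
    subtopology (pointwise_topology C C) (unary_part C \<C>) closure_of Gr C \<C> = unary_part C \<C>"

text \<open>The identity \<open>f(x\<^sub>1,\<dots>,x\<^sub>n) \<approx> g(y\<^sub>1,\<dots>,y\<^sub>k)\<close> is encoded as \<open>((f, xs), (g, ys))\<close>, with
  natural numbers as variables. A signature is a set \<open>\<Omega>\<close> of symbols with an arity function.\<close>

type_synonym 's h1_identity = "('s \<times> nat list) \<times> ('s \<times> nat list)"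

definition h1_identities_over :: "'s set \<Rightarrow> ('s \<Rightarrow> nat) \<Rightarrow> 's h1_identity set \<Rightarrow> bool"
  where "h1_identities_over \<Omega> ar E \<longleftrightarrow>
    (\<forall>s\<in>\<Omega>. ar s \<ge> 1) \<and>
    (\<forall>((f, xs), (g, ys))\<in>E. f \<in> \<Omega> \<and> g \<in> \<Omega> \<and> length xs = ar f \<and> length ys = ar g)"

definition eval_h1_term ::
    "('s \<Rightarrow> 'a operation) \<Rightarrow> (nat \<Rightarrow> 'a) \<Rightarrow> 's \<times> nat list \<Rightarrow> 'a"
  where "eval_h1_term I \<sigma> = (\<lambda>(f, xs). I f (\<lambda>i\<in>{..<length xs}. \<sigma> (xs ! i)))"

definition satisfies_h1 ::
    "'a set \<Rightarrow> (nat \<times> 'a operation) set \<Rightarrow> 's set \<Rightarrow> ('s \<Rightarrow> nat) \<Rightarrow> 's h1_identity set \<Rightarrow> bool"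
  where "satisfies_h1 C \<C> \<Omega> ar E \<longleftrightarrow>
    (\<exists>I. (\<forall>s\<in>\<Omega>. (ar s, I s) \<in> \<C>) \<and>
         (\<forall>(l, r)\<in>E. \<forall>\<sigma>\<in>UNIV \<rightarrow> C. eval_h1_term I \<sigma> l = eval_h1_term I \<sigma> r))"

text \<open>The choice of the two-element set is immaterial, see \<open>non_trivial_h1_iff\<close> below.\<close>

definition non_trivial_h1 :: "'s set \<Rightarrow> ('s \<Rightarrow> nat) \<Rightarrow> 's h1_identity set \<Rightarrow> bool"
  where "non_trivial_h1 \<Omega> ar E \<longleftrightarrow>
    \<not> satisfies_h1 (UNIV :: bool set) (projection_clone UNIV) \<Omega> ar E"

lemma satisfies_h1_projection_clone:
  fixes D :: "'b set"
  assumes E: "h1_identities_over \<Omega> ar E" and ab: "a \<in> D" "b \<in> D" "a \<noteq> b"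
  shows "satisfies_h1 D (projection_clone D) \<Omega> ar E \<longleftrightarrow>
    (\<exists>p. (\<forall>s\<in>\<Omega>. p s < ar s) \<and> (\<forall>((f, xs), (g, ys))\<in>E. xs ! p f = ys ! p g))"
    (is "?L \<longleftrightarrow> ?R")
proof
  assume ?L
  then obtain I where I: "\<forall>s\<in>\<Omega>. (ar s, I s) \<in> projection_clone D"
    and eq: "\<forall>(l, r)\<in>E. \<forall>\<sigma>\<in>UNIV \<rightarrow> D. eval_h1_term I \<sigma> l = eval_h1_term I \<sigma> r"
    unfolding satisfies_h1_def by blast
  have "\<forall>s\<in>\<Omega>. \<exists>i. i < ar s \<and> I s = projection D (ar s) i"
    using I by (auto simp: projection_clone_def)
  then obtain p where p: "\<forall>s\<in>\<Omega>. p s < ar s \<and> I s = projection D (ar s) (p s)"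
    by metis
  have "xs ! p f = ys ! p g" if e: "((f, xs), (g, ys)) \<in> E" for f xs g ys
  proof -
    have wf: "f \<in> \<Omega>" "g \<in> \<Omega>" "length xs = ar f" "length ys = ar g"
      using E e by (auto simp: h1_identities_over_def)
    define \<sigma> where "\<sigma> v = (if v = xs ! p f then a else b)" for v
    have \<sigma>: "\<sigma> \<in> UNIV \<rightarrow> D" using ab by (auto simp: \<sigma>_def)
    have "eval_h1_term I \<sigma> (f, xs) = eval_h1_term I \<sigma> (g, ys)"
      using eq e \<sigma> by fast
    then have "\<sigma> (xs ! p f) = \<sigma> (ys ! p g)"
      using p wf \<sigma> by (auto simp: eval_h1_term_def projection_def tuples_def Pi_iff)
    then show ?thesis using ab by (auto simp: \<sigma>_def split: if_splits)
  qed
  then show ?R using p by blast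
next
  assume ?R
  then obtain p where p: "\<forall>s\<in>\<Omega>. p s < ar s" "\<forall>((f, xs), (g, ys))\<in>E. xs ! p f = ys ! p g"
    by blast
  define I where "I s = projection D (ar s) (p s)" for s
  have "(ar s, I s) \<in> projection_clone D" if "s \<in> \<Omega>" for s
    using p that by (auto simp: I_def projection_clone_def)
  moreover have "eval_h1_term I \<sigma> l = eval_h1_term I \<sigma> r"
    if e: "(l, r) \<in> E" and \<sigma>: "\<sigma> \<in> UNIV \<rightarrow> D" for l r \<sigma>
  proof -
    obtain f xs g ys where lr: "l = (f, xs)" "r = (g, ys)" by (metis surj_pair)
    then have "f \<in> \<Omega>" "g \<in> \<Omega>" "length xs = ar f" "length ys = ar g" "xs ! p f = ys ! p g"
      using E e p by (auto simp: h1_identities_over_def)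
    then show ?thesis
      using p \<sigma> lr by (auto simp: I_def eval_h1_term_def projection_def tuples_def Pi_iff)
  qed
  ultimately show ?L unfolding satisfies_h1_def by blast
qed

lemma non_trivial_h1_iff:
  fixes D :: "'b set"
  assumes "h1_identities_over \<Omega> ar E" and "a \<in> D" "b \<in> D" "a \<noteq> b"
  shows "non_trivial_h1 \<Omega> ar E \<longleftrightarrow> \<not> satisfies_h1 D (projection_clone D) \<Omega> ar E"
  using satisfies_h1_projection_clone[OF assms]
    satisfies_h1_projection_clone[OF assms(1), of True UNIV False]
  by (simp add: non_trivial_h1_def)

definition K4_edges :: "(nat \<times> nat) list"
  where "K4_edges =
    [(1,2), (1,3), (1,4), (2,1), (2,3), (2,4), (3,1), (3,2), (3,4), (4,1), (4,2), (4,3)]"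

lemma K4_edges_enumerates:
  "distinct K4_edges" "length K4_edges = 12"
  "set K4_edges = {(a, b). a \<in> {1,2,3,4} \<and> b \<in> {1,2,3,4} \<and> a \<noteq> b}"
  by (auto simp: K4_edges_def)

text \<open>The entries of \<open>K4_edges\<close> are variables, valued by \<open>\<sigma>\<close>.\<close>

definition satisfies_pL24 :: "'a set \<Rightarrow> (nat \<times> 'a operation) set \<Rightarrow> bool"
  where "satisfies_pL24 C \<C> \<longleftrightarrow>
    (\<exists>u\<^sub>1\<in>unary_part C \<C>. \<exists>u\<^sub>2\<in>unary_part C \<C>. \<exists>f. (12, f) \<in> \<C> \<and>
      (\<forall>\<sigma>\<in>UNIV \<rightarrow> C.
        u\<^sub>1 (f (\<lambda>i\<in>{..<12}. \<sigma> (fst (K4_edges ! i)))) =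
        u\<^sub>2 (f (\<lambda>i\<in>{..<12}. \<sigma> (snd (K4_edges ! i))))))"

end

theory Submission
  imports Defs
begin

text \<open>Fix a finite set of coordinates \<open>Q\<close> and regard the \<open>Q\<close>-tuples over \<open>C\<close> up to the action of
  \<open>Gr \<C>\<close>; by oligomorphicity there are finitely many orbits. For points \<open>e\<^sub>i\<close> (\<open>i \<in> A\<close>) consider the
  invariant digraph generated by the complete loopless digraph on them. The loop condition for
  \<open>A\<close> says that this digraph always has an edge between two points of the same orbit.

  Satisfying the identities only up to \<open>Gr \<C>\<close>, all symbols of a finite non-trivial subset can be
  replaced by minors of one operation \<open>F\<close>, as a core clone acts on diagonals like elements of
  \<open>Gr \<C>\<close>. This gives a family of row pairs \<open>\<rho>\<close>, \<open>\<rho>'\<close> identified by \<open>F\<close> such that each \<open>\<rho>\<close>-column is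
  injective while no \<open>\<rho>'\<close>-column is onto \<open>A\<close>. In a smallest invariant set containing a clique
  \<open>e\<close>, the images of \<open>e\<close> under \<open>F \<circ> \<rho>\<close> then form a clique inside the neighbourhood of a single orbit,
  which is a smaller invariant set unless there is an edge within an orbit. The same argument,
  applied to an operation witnessing the loop condition for \<open>A\<close> instead of \<open>F\<close>, lowers the size of
  \<open>A\<close> to 4. Finally, compactness modulo \<open>Gr \<C>\<close> turns the local loop conditions into a global
  identity.\<close>

section \<open>Operations with arguments indexed by a finite set\<close>

locale clone =
  fixes C :: "'a set" and \<C> :: "(nat \<times> 'a operation) set"
  assumes clone: "function_clone C \<C>"
begin

lemma op_mem: "(n, f) \<in> \<C> \<Longrightarrow> 0 < n \<and> f \<in> tuples n C \<rightarrow>\<^sub>E C"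
  using clone by (auto simp: function_clone_def operations_def)

lemma projection_mem: "i < n \<Longrightarrow> (n, projection C n i) \<in> \<C>"
  using clone by (auto simp: function_clone_def)

lemma compose_mem:
  "(n, f) \<in> \<C> \<Longrightarrow> (\<And>i. i < n \<Longrightarrow> (m, g i) \<in> \<C>) \<Longrightarrow> (m, compose_op C n m f g) \<in> \<C>"
  using clone by (auto simp: function_clone_def)

lemma restrict_tuples: "(\<And>i. i < n \<Longrightarrow> x i \<in> C) \<Longrightarrow> restrict x {..<n} \<in> tuples n C"
  by (auto simp: tuples_def)

text \<open>Operations of \<open>\<C>\<close> with arguments indexed by \<open>J\<close>; only their values on \<open>J \<rightarrow> C\<close> matter.\<close>

definition idx_ops :: "'j set \<Rightarrow> (('j \<Rightarrow> 'a) \<Rightarrow> 'a) set"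
  where "idx_ops J = {F. \<exists>M h f. bij_betw h {..<M} J \<and> (M, f) \<in> \<C> \<and>
    (\<forall>x\<in>J \<rightarrow> C. F x = f (\<lambda>i\<in>{..<M}. x (h i)))}"

text \<open>The map \<open>g\<close> need be neither injective nor onto, so identified and dummy
  variables are both covered: \<open>k i\<close> is the position of \<open>g i\<close> in the
  enumeration \<open>h\<close>, and \<open>f\<close> is composed with the projections to these
  positions.\<close>

lemma reindex:
  assumes f: "(N, f) \<in> \<C>" and g: "g \<in> {..<N} \<rightarrow> J" and h: "bij_betw h {..<M} J"
  shows "\<exists>f'. (M, f') \<in> \<C> \<and>
    (\<forall>x\<in>J \<rightarrow> C. f' (\<lambda>i\<in>{..<M}. x (h i)) = f (\<lambda>i\<in>{..<N}. x (g i)))"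
proof -
  define k where "k i = inv_into {..<M} h (g i)" for i
  have k: "k i < M \<and> h (k i) = g i" if "i < N" for i
  proof -
    have "g i \<in> h ` {..<M}" using that g h by (auto simp: bij_betw_def)
    then show ?thesis
      unfolding k_def using inv_into_into[of "g i" h "{..<M}"] f_inv_into_f[of "g i" h "{..<M}"] by simp
  qed
  define f' where "f' = compose_op C N M f (\<lambda>i. projection C M (k i))"
  have "(M, f') \<in> \<C>"
    unfolding f'_def by (rule compose_mem[OF f]) (use k projection_mem in auto)
  moreover have "f' (\<lambda>i\<in>{..<M}. x (h i)) = f (\<lambda>i\<in>{..<N}. x (g i))" if x: "x \<in> J \<rightarrow> C" for x
  proof -
    have "x (h i) \<in> C" if "i < M" for i
      using x h that by (auto simp: bij_betw_def)
    then have t: "(\<lambda>i\<in>{..<M}. x (h i)) \<in> tuples M C"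
      by (intro restrict_tuples)
    have "(\<lambda>i\<in>{..<N}. projection C M (k i) (\<lambda>i\<in>{..<M}. x (h i))) = (\<lambda>i\<in>{..<N}. x (g i))"
      using t k by (auto simp: projection_def fun_eq_iff)
    then show ?thesis
      unfolding f'_def compose_op_def using t by simp
  qed
  ultimately show ?thesis by (intro exI[of _ f']) simp
qed

lemma idx_opsI:
  assumes "(N, f) \<in> \<C>" and "g \<in> {..<N} \<rightarrow> J" and "finite J"
    and F: "\<And>x. x \<in> J \<rightarrow> C \<Longrightarrow> F x = f (\<lambda>i\<in>{..<N}. x (g i))"
  shows "F \<in> idx_ops J"
proof -
  obtain h where "bij_betw h {0..<card J} J"
    using ex_bij_betw_nat_finite[OF assms(3)] by blast
  then have h: "bij_betw h {..<card J} J" by (simp add: atLeast0LessThan)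
  show ?thesis
    using reindex[OF assms(1,2) h] h F unfolding idx_ops_def by fastforce
qed

text \<open>\<open>idx_ops\<close> promises only some enumeration of \<open>J\<close>;
  \<open>reindex\<close> reaches any other one. This brings several operations to a common
  enumeration and later allows the order of \<open>K4_edges\<close>.\<close>

lemma idx_ops_bij:
  assumes "F \<in> idx_ops J" and h: "bij_betw h {..<M} J"
  shows "\<exists>f. (M, f) \<in> \<C> \<and> (\<forall>x\<in>J \<rightarrow> C. F x = f (\<lambda>i\<in>{..<M}. x (h i)))"
proof -
  obtain N g f where g: "bij_betw g {..<N} J" and f: "(N, f) \<in> \<C>"
    and F: "\<forall>x\<in>J \<rightarrow> C. F x = f (\<lambda>i\<in>{..<N}. x (g i))"
    using assms(1) unfolding idx_ops_def by blast
  have "g \<in> {..<N} \<rightarrow> J" using g by (auto simp: bij_betw_def)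
  from reindex[OF f this h] F show ?thesis by fastforce
qed

lemma idx_ops_finite: "F \<in> idx_ops J \<Longrightarrow> finite J \<and> J \<noteq> {}"
proof -
  assume "F \<in> idx_ops J"
  then obtain M h f where h: "bij_betw h {..<M} J" "(M, f) \<in> \<C>"
    unfolding idx_ops_def by blast
  then have "finite J" using bij_betw_finite by blast
  moreover have "J \<noteq> {}" using h op_mem[OF h(2)] by (auto simp: bij_betw_def)
  ultimately show ?thesis by simp
qed

lemma idx_ops_eq:
  assumes "F \<in> idx_ops J" and "\<And>j. j \<in> J \<Longrightarrow> x j = y j" and "x \<in> J \<rightarrow> C"
  shows "F x = F y"
proof -
  obtain M h f where h: "bij_betw h {..<M} J" and f: "(M, f) \<in> \<C>"
    and F: "\<forall>x\<in>J \<rightarrow> C. F x = f (\<lambda>i\<in>{..<M}. x (h i))"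
    using assms(1) unfolding idx_ops_def by blast
  have "h i \<in> J" if "i < M" for i using h that by (auto simp: bij_betw_def)
  then have "(\<lambda>i\<in>{..<M}. x (h i)) = (\<lambda>i\<in>{..<M}. y (h i))"
    using assms(2) by (auto simp: fun_eq_iff)
  moreover have "y \<in> J \<rightarrow> C" using assms(2,3) by force
  ultimately show ?thesis using F assms(3) by simp
qed

lemma idx_ops_closed:
  assumes "F \<in> idx_ops J" and "x \<in> J \<rightarrow> C"
  shows "F x \<in> C"
proof -
  obtain M h f where h: "bij_betw h {..<M} J" and f: "(M, f) \<in> \<C>"
    and F: "\<forall>x\<in>J \<rightarrow> C. F x = f (\<lambda>i\<in>{..<M}. x (h i))"
    using assms(1) unfolding idx_ops_def by blast
  have "(\<lambda>i\<in>{..<M}. x (h i)) \<in> tuples M C"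
    using h assms(2) by (intro restrict_tuples) (auto simp: bij_betw_def)
  then show ?thesis using F assms(2) op_mem[OF f] by auto
qed

lemma idx_ops_proj: "finite J \<Longrightarrow> j \<in> J \<Longrightarrow> (\<lambda>x. x j) \<in> idx_ops J"
  by (rule idx_opsI[OF projection_mem[of 0 1], of "\<lambda>_. j"])
    (auto simp: projection_def tuples_def PiE_iff extensional_def)

lemma idx_ops_comp:
  assumes F: "F \<in> idx_ops I" and G: "\<And>i. i \<in> I \<Longrightarrow> G i \<in> idx_ops J" and J: "finite J"
  shows "(\<lambda>x. F (\<lambda>i. G i x)) \<in> idx_ops J"
proof -
  obtain N g f where g: "bij_betw g {..<N} I" and f: "(N, f) \<in> \<C>"
    and Ff: "\<forall>x\<in>I \<rightarrow> C. F x = f (\<lambda>i\<in>{..<N}. x (g i))"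
    using F unfolding idx_ops_def by blast
  have gI: "g k \<in> I" if "k < N" for k using g that by (auto simp: bij_betw_def)
  obtain h where "bij_betw h {0..<card J} J"
    using ex_bij_betw_nat_finite[OF J] by blast
  then have h: "bij_betw h {..<card J} J" by (simp add: atLeast0LessThan)
  let ?M = "card J"
  have "\<forall>k<N. \<exists>f'. (?M, f') \<in> \<C> \<and> (\<forall>x\<in>J \<rightarrow> C. G (g k) x = f' (\<lambda>i\<in>{..<?M}. x (h i)))"
    using idx_ops_bij[OF G h] gI by blast
  then obtain f' where f': "\<And>k. k < N \<Longrightarrow> (?M, f' k) \<in> \<C>"
    "\<And>k x. k < N \<Longrightarrow> x \<in> J \<rightarrow> C \<Longrightarrow> G (g k) x = f' k (\<lambda>i\<in>{..<?M}. x (h i))"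
    by metis
  have c: "(?M, compose_op C N ?M f f') \<in> \<C>" using compose_mem f f' by blast
  have hJ: "h \<in> {..<?M} \<rightarrow> J" using h by (auto simp: bij_betw_def)
  show ?thesis
  proof (rule idx_opsI[OF c hJ J])
    fix x assume x: "x \<in> J \<rightarrow> C"
    have t: "(\<lambda>i\<in>{..<?M}. x (h i)) \<in> tuples ?M C"
      using x hJ by (intro restrict_tuples) auto
    have "(\<lambda>i. G i x) \<in> I \<rightarrow> C" using idx_ops_closed[OF G x] by auto
    then have *: "F (\<lambda>i. G i x) = f (\<lambda>k\<in>{..<N}. G (g k) x)" using Ff by simp
    have "(\<lambda>k\<in>{..<N}. G (g k) x) = (\<lambda>k\<in>{..<N}. f' k (\<lambda>i\<in>{..<?M}. x (h i)))"
      using f'(2) x by (intro restrict_ext) auto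
    with * show "F (\<lambda>i. G i x) = compose_op C N ?M f f' (\<lambda>i\<in>{..<?M}. x (h i))"
      unfolding compose_op_def using t by (simp add: restrict_apply' del: restrict_apply)
  qed
qed

lemma idx_ops_minor:
  assumes "F \<in> idx_ops I" and "m \<in> I \<rightarrow> J" and "finite J"
  shows "(\<lambda>x. F (\<lambda>i. x (m i))) \<in> idx_ops J"
  using assms by (intro idx_ops_comp[OF assms(1) idx_ops_proj]) auto

lemma idx_ops_op: "(n, f) \<in> \<C> \<Longrightarrow> (\<lambda>x. f (restrict x {..<n})) \<in> idx_ops {..<n}"
  by (rule idx_opsI[where g = "\<lambda>i. i"]) auto

lemma idx_ops_op_ex:
  assumes "F \<in> idx_ops {..<n}"
  shows "\<exists>f. (n, f) \<in> \<C> \<and> (\<forall>x\<in>{..<n} \<rightarrow> C. F x = f (restrict x {..<n}))"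
  using idx_ops_bij[OF assms bij_betw_id] by (simp add: restrict_def id_def)

lemma unary_part_idx_ops:
  assumes "u \<in> unary_part C \<C>" and "finite J" and "j \<in> J"
  shows "(\<lambda>x. u (x j)) \<in> idx_ops J"
proof (rule idx_opsI[where f = "unary_op C u" and N = 1 and g = "\<lambda>_. j"])
  show "(1, unary_op C u) \<in> \<C>" using assms(1) by (simp add: unary_part_def)
  show "u (x j) = unary_op C u (\<lambda>i\<in>{..<1}. x j)" if "x \<in> J \<rightarrow> C" for x
    using that assms(3) by (auto simp: unary_op_def tuples_def PiE_iff extensional_def)
qed (use assms in auto)

text \<open>Diagonals are the link to the group: as unary members of the clone they are approximated
  by elements of \<open>Gr\<close> once the clone is a core.\<close>

lemma idx_ops_unary_part:
  assumes "F \<in> idx_ops J"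
  shows "(\<lambda>c\<in>C. F (\<lambda>_. c)) \<in> unary_part C \<C>"
proof -
  have "(\<lambda>x. F (\<lambda>i. x (0::nat))) \<in> idx_ops {..<1}"
    by (rule idx_ops_minor[OF assms]) auto
  then obtain f where f: "(1, f) \<in> \<C>" "\<forall>x\<in>{..<1} \<rightarrow> C. F (\<lambda>i. x 0) = f (restrict x {..<1})"
    using idx_ops_op_ex by blast
  have "unary_op C (\<lambda>c\<in>C. F (\<lambda>_. c)) = f"
  proof
    fix x
    show "unary_op C (\<lambda>c\<in>C. F (\<lambda>_. c)) x = f x"
    proof (cases "x \<in> tuples 1 C")
      case True
      then have "restrict x {..<1} = x" "x \<in> {..<1} \<rightarrow> C"
        by (auto simp: tuples_def PiE_iff extensional_restrict)
      then show ?thesis using f(2) True by (auto simp: unary_op_def tuples_def)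
    next
      case False
      then show ?thesis using op_mem[OF f(1)] by (auto simp: unary_op_def)
    qed
  qed
  moreover have "(\<lambda>c\<in>C. F (\<lambda>_. c)) \<in> C \<rightarrow>\<^sub>E C"
    using idx_ops_closed[OF assms] by auto
  ultimately show ?thesis using f(1) by (simp add: unary_part_def)
qed

section \<open>The group of the clone and conjugacy of tuples\<close>

abbreviation G :: "('a \<Rightarrow> 'a) set"
  where "G \<equiv> Gr C \<C>"

lemma G_unary: "\<alpha> \<in> G \<Longrightarrow> \<alpha> \<in> unary_part C \<C>"
  by (simp add: Gr_def)

lemma G_closed: "\<alpha> \<in> G \<Longrightarrow> c \<in> C \<Longrightarrow> \<alpha> c \<in> C"
  by (auto simp: Gr_def unary_part_def)

lemma unary_part_comp:
  assumes "u \<in> unary_part C \<C>" and "v \<in> unary_part C \<C>"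
  shows "(\<lambda>c\<in>C. u (v c)) \<in> unary_part C \<C>"
proof -
  have "(\<lambda>x. u (v (x ()))) \<in> idx_ops {()}"
    using idx_ops_comp[OF unary_part_idx_ops[OF assms(1), of "{()}" "()"], of "\<lambda>_ x. v (x ())" "{()}"]
      unary_part_idx_ops[OF assms(2), of "{()}" "()"] by simp
  from idx_ops_unary_part[OF this] show ?thesis by simp
qed

lemma G_inv:
  assumes "\<alpha> \<in> G"
  shows "\<exists>\<beta>\<in>G. \<forall>c\<in>C. \<beta> (\<alpha> c) = c \<and> \<alpha> (\<beta> c) = c"
proof
  let ?\<beta> = "restrict (inv_into C \<alpha>) C"
  have b: "bij_betw \<alpha> C C" and u: "\<alpha> \<in> unary_part C \<C>" and i: "?\<beta> \<in> unary_part C \<C>"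
    using assms by (auto simp: Gr_def)
  show *: "\<forall>c\<in>C. ?\<beta> (\<alpha> c) = c \<and> \<alpha> (?\<beta> c) = c"
    using b by (auto simp: bij_betw_def f_inv_into_f inv_into_f_f)
  have b': "bij_betw ?\<beta> C C"
    using bij_betw_inv_into[OF b] by (rule bij_betw_cong[THEN iffD1, rotated]) simp
  \<comment> \<open>Equality as functions, not only on \<open>C\<close>, holds because \<alpha> is
    extensional; membership of the inverse in \<open>G\<close> refers to exactly this
    function.\<close>
  have "restrict (inv_into C ?\<beta>) C = \<alpha>"
  proof
    fix c
    show "restrict (inv_into C ?\<beta>) C c = \<alpha> c"
    proof (cases "c \<in> C")
      case True
      then have "\<alpha> c \<in> C" "?\<beta> (\<alpha> c) = c" using * b by (auto simp: bij_betw_def)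
      then show ?thesis using b' True by (metis bij_betw_def inv_into_f_f restrict_apply')
    next
      case False
      then show ?thesis using u by (auto simp: unary_part_def)
    qed
  qed
  then show "?\<beta> \<in> G" using b' i u by (simp add: Gr_def)
qed

lemma G_comp:
  assumes "\<alpha> \<in> G" and "\<beta> \<in> G"
  shows "\<exists>\<gamma>\<in>G. \<forall>c\<in>C. \<gamma> c = \<alpha> (\<beta> c)"
proof
  let ?\<gamma> = "\<lambda>c\<in>C. \<alpha> (\<beta> c)"
  show "\<forall>c\<in>C. ?\<gamma> c = \<alpha> (\<beta> c)" by simp
  have b: "bij_betw ?\<gamma> C C"
  proof -
    have "bij_betw (\<alpha> \<circ> \<beta>) C C"
      using assms bij_betw_trans by (auto simp: Gr_def)
    then show ?thesis by (rule bij_betw_cong[THEN iffD1, rotated]) simp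
  qed
  obtain \<alpha>' \<beta>' where i: "\<alpha>' \<in> G" "\<beta>' \<in> G" "\<forall>c\<in>C. \<alpha>' (\<alpha> c) = c \<and> \<alpha> (\<alpha>' c) = c"
    "\<forall>c\<in>C. \<beta>' (\<beta> c) = c \<and> \<beta> (\<beta>' c) = c"
    using G_inv assms by meson
  have "restrict (inv_into C ?\<gamma>) C = (\<lambda>c\<in>C. \<beta>' (\<alpha>' c))"
  proof
    fix c
    show "restrict (inv_into C ?\<gamma>) C c = (\<lambda>c\<in>C. \<beta>' (\<alpha>' c)) c"
    proof (cases "c \<in> C")
      case True
      then have "\<beta>' (\<alpha>' c) \<in> C" "?\<gamma> (\<beta>' (\<alpha>' c)) = c"
        using i by (auto simp: G_closed)
      then have "inv_into C ?\<gamma> c = \<beta>' (\<alpha>' c)"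
        using b by (metis bij_betw_def inv_into_f_f)
      then show ?thesis using True by simp
    qed simp
  qed
  then show "?\<gamma> \<in> G"
    using b unary_part_comp[OF G_unary G_unary] assms i(1,2) by (simp add: Gr_def)
qed

lemma G_id: "\<exists>\<gamma>\<in>G. \<forall>c\<in>C. \<gamma> c = c"
proof -
  have u: "(\<lambda>c\<in>C. c) \<in> unary_part C \<C>"
    using idx_ops_unary_part[OF idx_ops_proj[of "{()}" "()"]] by simp
  have b: "bij_betw (\<lambda>c\<in>C. c) C C"
    by (auto simp: bij_betw_def inj_on_def)
  have "restrict (inv_into C (\<lambda>c\<in>C. c)) C = (\<lambda>c\<in>C. c)"
  proof
    fix c
    show "restrict (inv_into C (\<lambda>c\<in>C. c)) C c = (\<lambda>c\<in>C. c) c"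
      using inv_into_f_f[of "\<lambda>c\<in>C. c" C c] b by (auto simp: bij_betw_def)
  qed
  then have "(\<lambda>c\<in>C. c) \<in> G" using u b by (simp add: Gr_def)
  then show ?thesis by (intro bexI[of _ "\<lambda>c\<in>C. c"]) auto
qed

text \<open>Lying in one orbit of the componentwise action, in a form that ignores values outside
  \<open>Q\<close>, so that non-extensional tuples can be compared too.\<close>

definition conj_on :: "'q set \<Rightarrow> ('q \<Rightarrow> 'a) \<Rightarrow> ('q \<Rightarrow> 'a) \<Rightarrow> bool"
  where "conj_on Q u v \<longleftrightarrow> (\<exists>\<alpha>\<in>G. \<forall>d\<in>Q. v d = \<alpha> (u d))"

lemma conj_on_sym:
  assumes "u \<in> Q \<rightarrow> C" and "conj_on Q u v"
  shows "conj_on Q v u"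
proof -
  obtain \<alpha> where a: "\<alpha> \<in> G" "\<forall>d\<in>Q. v d = \<alpha> (u d)" using assms(2) by (auto simp: conj_on_def)
  obtain \<beta> where "\<beta> \<in> G" "\<forall>c\<in>C. \<beta> (\<alpha> c) = c" using G_inv[OF a(1)] by blast
  then show ?thesis unfolding conj_on_def using a assms(1) by (intro bexI[of _ \<beta>]) (auto simp: Pi_iff)
qed

lemma conj_on_trans:
  assumes "u \<in> Q \<rightarrow> C" and "conj_on Q u v" and "conj_on Q v w"
  shows "conj_on Q u w"
proof -
  obtain \<alpha> \<beta> where a: "\<alpha> \<in> G" "\<forall>d\<in>Q. v d = \<alpha> (u d)" "\<beta> \<in> G" "\<forall>d\<in>Q. w d = \<beta> (v d)"
    using assms(2,3) by (auto simp: conj_on_def)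
  obtain \<gamma> where "\<gamma> \<in> G" "\<forall>c\<in>C. \<gamma> c = \<beta> (\<alpha> c)" using G_comp[OF a(3,1)] by blast
  then show ?thesis unfolding conj_on_def using a assms(1) by (intro bexI[of _ \<gamma>]) (auto simp: Pi_iff)
qed

lemma conj_on_refl:
  assumes "u \<in> Q \<rightarrow> C"
  shows "conj_on Q u u"
proof -
  obtain \<iota> where "\<iota> \<in> G" "\<forall>c\<in>C. \<iota> c = c" using G_id by blast
  then show ?thesis unfolding conj_on_def using assms by (intro bexI[of _ \<iota>]) (auto simp: Pi_iff)
qed

end

section \<open>The loop condition\<close>

lemma finite_image_factor:
  assumes "finite (f ` A)" and "\<And>x y. x \<in> A \<Longrightarrow> y \<in> A \<Longrightarrow> f x = f y \<Longrightarrow> g x = g y"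
  shows "finite (g ` A)"
proof -
  have "g ` A \<subseteq> (\<lambda>b. g (inv_into A f b)) ` f ` A"
  proof
    fix c assume "c \<in> g ` A"
    then obtain x where x: "x \<in> A" "c = g x" by (rule imageE)
    then have "g (inv_into A f (f x)) = g x"
      by (intro assms(2) inv_into_into f_inv_into_f imageI)
    then show "c \<in> (\<lambda>b. g (inv_into A f b)) ` f ` A"
      unfolding x(2) using x(1) by (metis imageI)
  qed
  then show ?thesis using assms(1) finite_imageI finite_subset by metis
qed

definition off_diag :: "'i set \<Rightarrow> ('i \<times> 'i) set"
  where "off_diag A = {(i, j). i \<in> A \<and> j \<in> A \<and> i \<noteq> j}"

lemma finite_off_diag: "finite A \<Longrightarrow> finite (off_diag A)"
  by (rule finite_subset[of _ "A \<times> A"]) (auto simp: off_diag_def)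

section \<open>Operations of a core clone act locally like group elements\<close>

locale oligomorphic_core = clone +
  assumes oligomorphic: "oligomorphic C \<C>"
    and core: "core_clone C \<C>"
begin

text \<open>The functions that agree with \<open>u\<close> on the finite set \<open>S\<close> form
  an open neighbourhood of \<open>u\<close>, which meets \<open>G\<close> by density.\<close>

lemma unary_approx:
  assumes u: "u \<in> unary_part C \<C>" and S: "finite S" "S \<subseteq> C"
  shows "\<exists>\<gamma>\<in>G. \<forall>c\<in>S. u c = \<gamma> c"
proof -
  let ?X = "product_topology (\<lambda>_. discrete_topology C) C"
  let ?T = "\<Pi>\<^sub>E c\<in>C. if c \<in> S then {u c} else C"
  have uC: "u \<in> C \<rightarrow>\<^sub>E C" using u by (auto simp: unary_part_def)
  have "openin ?X ?T"
  proof (subst openin_PiE_gen, intro disjI2 conjI ballI)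
    show "finite {c \<in> C. (if c \<in> S then {u c} else C) \<noteq> topspace (discrete_topology C)}"
      by (rule finite_subset[OF _ S(1)]) auto
    show "openin (discrete_topology C) (if c \<in> S then {u c} else C)" if "c \<in> C" for c
      using uC that by auto
  qed
  then have "openin (subtopology ?X (unary_part C \<C>)) (?T \<inter> unary_part C \<C>)"
    by (auto simp: openin_subtopology)
  moreover have "u \<in> ?T \<inter> unary_part C \<C>" using u uC by (auto simp: PiE_iff)
  moreover have "u \<in> subtopology ?X (unary_part C \<C>) closure_of G"
    using core u by (simp add: core_clone_def pointwise_topology_def)
  ultimately obtain \<gamma> where "\<gamma> \<in> G" "\<gamma> \<in> ?T" by (auto simp: in_closure_of)
  then have "\<forall>c\<in>S. u c = \<gamma> c" using S by (fastforce simp: PiE_iff split: if_splits)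
  then show ?thesis using \<open>\<gamma> \<in> G\<close> by blast
qed

lemma idx_ops_approx:
  assumes F: "F \<in> idx_ops J" and \<gamma>: "\<And>j. j \<in> J \<Longrightarrow> \<gamma> j \<in> G" and S: "finite S" "S \<subseteq> C"
  shows "\<exists>\<alpha>\<in>G. \<forall>c\<in>S. F (\<lambda>j. \<gamma> j c) = \<alpha> c"
proof -
  have "(\<lambda>x. F (\<lambda>j. \<gamma> j (x ()))) \<in> idx_ops {()}"
    by (rule idx_ops_comp[OF F unary_part_idx_ops]) (use \<gamma> G_unary in auto)
  from idx_ops_unary_part[OF this]
  have "(\<lambda>c\<in>C. F (\<lambda>j. \<gamma> j c)) \<in> unary_part C \<C>" .
  from unary_approx[OF this S] S(2) show ?thesis by (auto simp: subset_iff)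
qed

text \<open>In a core, orbits are closed under the operations of the clone: with each
  \<open>w j\<close> written as \<open>\<gamma> j\<close> applied to \<open>z\<close>, the result is
  a unary member applied to \<open>z\<close>, and on the finitely many values of \<open>z\<close>
  this is a group element.\<close>

lemma conj_on_idx_ops:
  assumes F: "F \<in> idx_ops J" and w: "\<And>j. j \<in> J \<Longrightarrow> conj_on Q z (w j)"
    and z: "z \<in> Q \<rightarrow> C" and Q: "finite Q"
  shows "conj_on Q z (\<lambda>d. F (\<lambda>j. w j d))"
proof -
  have "\<forall>j\<in>J. \<exists>g. g \<in> G \<and> (\<forall>d\<in>Q. w j d = g (z d))"
    using w unfolding conj_on_def by blast
  from bchoice[OF this] obtain \<gamma>
    where \<gamma>: "\<forall>j\<in>J. \<gamma> j \<in> G \<and> (\<forall>d\<in>Q. w j d = \<gamma> j (z d))" ..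
  obtain \<alpha> where \<alpha>: "\<alpha> \<in> G" "\<forall>c\<in>z ` Q. F (\<lambda>j. \<gamma> j c) = \<alpha> c"
    using idx_ops_approx[OF F, of \<gamma> "z ` Q"] \<gamma> z Q by auto
  have "F (\<lambda>j. w j d) = \<alpha> (z d)" if d: "d \<in> Q" for d
  proof -
    have "(\<lambda>j. \<gamma> j (z d)) \<in> J \<rightarrow> C" using \<gamma> z d G_closed by (auto simp: Pi_iff)
    then have "F (\<lambda>j. \<gamma> j (z d)) = F (\<lambda>j. w j d)"
      using \<gamma> d by (intro idx_ops_eq[OF F]) auto
    then show ?thesis using \<alpha>(2) d by simp
  qed
  then show ?thesis unfolding conj_on_def using \<alpha>(1) by blast
qed

section \<open>Orbits of tuples and their finite number\<close>

definition orb :: "'q set \<Rightarrow> ('q \<Rightarrow> 'a) \<Rightarrow> ('q \<Rightarrow> 'a) set"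
  where "orb Q v = {w \<in> Q \<rightarrow>\<^sub>E C. conj_on Q v w}"

lemma orb_eqI:
  assumes "v \<in> Q \<rightarrow> C" "w \<in> Q \<rightarrow> C" "conj_on Q v w"
  shows "orb Q v = orb Q w"
  using conj_on_trans[OF assms(1,3)] conj_on_trans[OF assms(2) conj_on_sym[OF assms(1,3)]]
  unfolding orb_def by blast

lemma orb_eqD: "v \<in> Q \<rightarrow> C \<Longrightarrow> w \<in> Q \<rightarrow>\<^sub>E C \<Longrightarrow> orb Q v = orb Q w \<Longrightarrow> conj_on Q v w"
  using conj_on_refl[of w Q] by (auto simp: orb_def PiE_def)

lemma finite_orbs:
  assumes Q: "finite Q"
  shows "finite (orb Q ` (Q \<rightarrow> C))"
\<comment> \<open>The empty index set is separate because \<open>oligomorphic\<close> speaks only of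
  tuples of length at least 1.\<close>
proof (cases "Q = {}")
  case True
  then have "orb Q ` (Q \<rightarrow> C) \<subseteq> Pow {\<lambda>_. undefined}" unfolding orb_def by auto
  then show ?thesis by (rule finite_subset) simp
next
  case False
  define k where "k = card Q"
  obtain h where h0: "bij_betw h {0..<k} Q"
    unfolding k_def using ex_bij_betw_nat_finite[OF Q] by blast
  then have h: "bij_betw h {..<k} Q" by (simp add: atLeast0LessThan)
  have hQ: "h i \<in> Q" if "i < k" for i using h that by (auto simp: bij_betw_def)
  have k: "k \<ge> 1" using Q False by (auto simp: k_def card_gt_0_iff Suc_le_eq)
  define t where "t v = (\<lambda>i\<in>{..<k}. v (h i))" for v :: "'b \<Rightarrow> 'a"
  have t: "t v \<in> tuples k C" if "v \<in> Q \<rightarrow> C" for v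
    unfolding t_def using that hQ by (intro restrict_tuples) auto
  show ?thesis
  proof (rule finite_image_factor[where f = "\<lambda>v. orbit_of_tuple G k (t v)"])
    show "finite ((\<lambda>v. orbit_of_tuple G k (t v)) ` (Q \<rightarrow> C))"
    proof (rule finite_subset)
      show "(\<lambda>v. orbit_of_tuple G k (t v)) ` (Q \<rightarrow> C) \<subseteq> orbit_of_tuple G k ` tuples k C"
        using t by blast
      show "finite (orbit_of_tuple G k ` tuples k C)"
        using oligomorphic k by (simp add: oligomorphic_def)
    qed
    fix v w assume vw: "v \<in> Q \<rightarrow> C" "w \<in> Q \<rightarrow> C" and eq: "orbit_of_tuple G k (t v) = orbit_of_tuple G k (t w)"
    obtain \<iota> where \<iota>: "\<iota> \<in> G" "\<forall>c\<in>C. \<iota> c = c" using G_id by blast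
    have tw: "t w = (\<lambda>i\<in>{..<k}. \<iota> (t w i))"
      unfolding t_def using vw(2) hQ \<iota>(2) by (intro restrict_ext) (simp add: Pi_iff)
    have "t w \<in> orbit_of_tuple G k (t w)"
      unfolding orbit_of_tuple_def by (rule CollectI, rule exI[of _ \<iota>], rule conjI[OF tw \<iota>(1)])
    then have "t w \<in> orbit_of_tuple G k (t v)" using eq by simp
    then have "\<exists>u. t w = (\<lambda>i\<in>{..<k}. u (t v i)) \<and> u \<in> G"
      unfolding orbit_of_tuple_def by (rule CollectD)
    then obtain u where u': "t w = (\<lambda>i\<in>{..<k}. u (t v i)) \<and> u \<in> G" ..
    have u: "u \<in> G" "t w = (\<lambda>i\<in>{..<k}. u (t v i))" by (rule conjunct2[OF u'], rule conjunct1[OF u'])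
    have "w d = u (v d)" if "d \<in> Q" for d
    proof -
      have "d \<in> h ` {..<k}" using h that by (simp add: bij_betw_def)
      then obtain i where "i < k" "d = h i" by auto
      then show ?thesis using fun_cong[OF u(2), of i] by (simp add: t_def)
    qed
    then show "orb Q v = orb Q w" using u(1) vw by (intro orb_eqI) (auto simp: conj_on_def)
  qed
qed

text \<open>The two conjugate tuples are the ends of a typical edge of the generated digraph, as
  \<open>F\<close> has one argument for each generating edge. Coordinates are natural numbers since
  a definition cannot quantify over types; other finite index sets are encoded.\<close>

definition loop_cond :: "'i set \<Rightarrow> bool"
  where "loop_cond A \<longleftrightarrow> (\<forall>(Q :: nat set) e. finite Q \<longrightarrow> (\<forall>i\<in>A. e i \<in> Q \<rightarrow> C) \<longrightarrow>
    (\<exists>F\<in>idx_ops (off_diag A).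
      conj_on Q (\<lambda>d. F (\<lambda>p. e (fst p) d)) (\<lambda>d. F (\<lambda>p. e (snd p) d))))"

text \<open>The rows are required for every \<open>e\<close> because they are applied to a clique
  that appears only inside the proof. Injective \<rho>-columns map cliques to cliques; the value
  missed by each \<rho>'-column supplies a common neighbour.\<close>

lemma loop_condI:
  fixes A :: "'i set"
  assumes fin: "finite A"
    and rows: "\<And>(Q :: nat set) e. finite Q \<Longrightarrow> (\<And>i. i \<in> A \<Longrightarrow> e i \<in> Q \<rightarrow> C) \<Longrightarrow>
      \<exists>(J :: 'j set) F \<rho> \<rho>'. F \<in> idx_ops J \<and>
        (\<forall>j\<in>J. inj_on (\<lambda>i. \<rho> i j) A \<and> (\<lambda>i. \<rho> i j) ` A \<subseteq> A \<and> (\<lambda>i. \<rho>' i j) ` A \<subset> A) \<and>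
        (\<forall>i\<in>A. conj_on Q (\<lambda>d. F (\<lambda>j. e (\<rho> i j) d)) (\<lambda>d. F (\<lambda>j. e (\<rho>' i j) d)))"
  shows "loop_cond A"
  unfolding loop_cond_def
proof (intro allI impI, rule ccontr)
  fix Q :: "nat set" and \<kappa> :: "'i \<Rightarrow> nat \<Rightarrow> 'a"
  assume Q: "finite Q" and \<kappa>: "\<forall>i\<in>A. \<kappa> i \<in> Q \<rightarrow> C"
    and no_loop: "\<not> (\<exists>F\<in>idx_ops (off_diag A).
      conj_on Q (\<lambda>d. F (\<lambda>p. \<kappa> (fst p) d)) (\<lambda>d. F (\<lambda>p. \<kappa> (snd p) d)))"
  define act where "act F v = (\<lambda>d\<in>Q. F (\<lambda>j. v j d))" for F :: "('j \<Rightarrow> 'a) \<Rightarrow> 'a" and v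
  define H where "H = {(\<lambda>d\<in>Q. F (\<lambda>p. \<kappa> (fst p) d), \<lambda>d\<in>Q. F (\<lambda>p. \<kappa> (snd p) d)) | F.
    F \<in> idx_ops (off_diag A)}"
  \<comment> \<open>Invariance is asked only for index sets of type \<open>'j\<close>, the type on
    which the given operations live.\<close>
  define inv where "inv S \<longleftrightarrow> S \<subseteq> (Q \<rightarrow>\<^sub>E C) \<and>
    (\<forall>(J :: 'j set) F v. F \<in> idx_ops J \<longrightarrow> (\<forall>j\<in>J. v j \<in> S) \<longrightarrow> act F v \<in> S)" for S
  define clique where "clique e S \<longleftrightarrow> (\<forall>i\<in>A. e i \<in> S) \<and> (\<forall>i\<in>A. \<forall>i'\<in>A. i \<noteq> i' \<longrightarrow> (e i, e i') \<in> H)"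
    for e :: "'i \<Rightarrow> nat \<Rightarrow> 'a" and S
  have \<kappa>C: "\<kappa> i d \<in> C" if "i \<in> A" "d \<in> Q" for i d using \<kappa> that by auto
  have fst_C: "(\<lambda>p. \<kappa> (fst p) d) \<in> off_diag A \<rightarrow> C" if "d \<in> Q" for d
    using \<kappa>C that by (auto simp: off_diag_def)
  have snd_C: "(\<lambda>p. \<kappa> (snd p) d) \<in> off_diag A \<rightarrow> C" if "d \<in> Q" for d
    using \<kappa>C that by (auto simp: off_diag_def)
  have HI: "(\<lambda>d\<in>Q. F (\<lambda>p. \<kappa> (fst p) d), \<lambda>d\<in>Q. F (\<lambda>p. \<kappa> (snd p) d)) \<in> H"
    if "F \<in> idx_ops (off_diag A)" for F
    unfolding H_def by (rule CollectI, rule exI[of _ F], rule conjI[OF refl that])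
  have HE: "\<exists>F. F \<in> idx_ops (off_diag A) \<and> u = (\<lambda>d\<in>Q. F (\<lambda>p. \<kappa> (fst p) d)) \<and>
      v = (\<lambda>d\<in>Q. F (\<lambda>p. \<kappa> (snd p) d))" if uv: "(u, v) \<in> H" for u v
  proof -
    obtain F where "(u, v) = (\<lambda>d\<in>Q. F (\<lambda>p. \<kappa> (fst p) d), \<lambda>d\<in>Q. F (\<lambda>p. \<kappa> (snd p) d)) \<and>
        F \<in> idx_ops (off_diag A)"
      using CollectD[OF uv[unfolded H_def]] ..
    then show ?thesis by (intro exI[of _ F]) simp
  qed
  have H_C: "u \<in> Q \<rightarrow>\<^sub>E C \<and> v \<in> Q \<rightarrow>\<^sub>E C" if uv: "(u, v) \<in> H" for u v
  proof -
    obtain K where K': "K \<in> idx_ops (off_diag A) \<and>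
      u = (\<lambda>d\<in>Q. K (\<lambda>p. \<kappa> (fst p) d)) \<and> v = (\<lambda>d\<in>Q. K (\<lambda>p. \<kappa> (snd p) d))"
      using HE[OF uv] ..
    then have K: "K \<in> idx_ops (off_diag A)" and u: "u = (\<lambda>d\<in>Q. K (\<lambda>p. \<kappa> (fst p) d))"
      and v: "v = (\<lambda>d\<in>Q. K (\<lambda>p. \<kappa> (snd p) d))" by simp_all
    show ?thesis unfolding u v using idx_ops_closed[OF K fst_C] idx_ops_closed[OF K snd_C] by simp
  qed
  have H_inv: "(act F u, act F v) \<in> H"
    if F: "F \<in> idx_ops J" and uv: "\<And>j. j \<in> J \<Longrightarrow> (u j, v j) \<in> H" for J F u v
  proof -
    have "\<forall>j\<in>J. \<exists>K. K \<in> idx_ops (off_diag A) \<and> u j = (\<lambda>d\<in>Q. K (\<lambda>p. \<kappa> (fst p) d)) \<and>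
        v j = (\<lambda>d\<in>Q. K (\<lambda>p. \<kappa> (snd p) d))"
      by (intro ballI HE uv)
    from bchoice[OF this] obtain K where K': "\<forall>j\<in>J. K j \<in> idx_ops (off_diag A) \<and>
        u j = (\<lambda>d\<in>Q. K j (\<lambda>p. \<kappa> (fst p) d)) \<and> v j = (\<lambda>d\<in>Q. K j (\<lambda>p. \<kappa> (snd p) d))" ..
    have K: "K j \<in> idx_ops (off_diag A)" "u j = (\<lambda>d\<in>Q. K j (\<lambda>p. \<kappa> (fst p) d))"
      "v j = (\<lambda>d\<in>Q. K j (\<lambda>p. \<kappa> (snd p) d))" if "j \<in> J" for j
      using bspec[OF K' that] by simp_all
    have KC: "(\<lambda>j. K j (\<lambda>p. \<kappa> (fst p) d)) \<in> J \<rightarrow> C" "(\<lambda>j. K j (\<lambda>p. \<kappa> (snd p) d)) \<in> J \<rightarrow> C"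
      if d: "d \<in> Q" for d
      by (rule Pi_I, erule idx_ops_closed[OF K(1) fst_C[OF d]])
        (rule Pi_I, erule idx_ops_closed[OF K(1) snd_C[OF d]])
    have "act F u = (\<lambda>d\<in>Q. F (\<lambda>j. K j (\<lambda>p. \<kappa> (fst p) d)))"
      unfolding act_def
    proof (rule restrict_ext)
      fix d assume d: "d \<in> Q"
      show "F (\<lambda>j. u j d) = F (\<lambda>j. K j (\<lambda>p. \<kappa> (fst p) d))"
        by (rule idx_ops_eq[OF F _ KC(1)[OF d], symmetric]) (simp add: K(2) d)
    qed
    moreover have "act F v = (\<lambda>d\<in>Q. F (\<lambda>j. K j (\<lambda>p. \<kappa> (snd p) d)))"
      unfolding act_def
    proof (rule restrict_ext)
      fix d assume d: "d \<in> Q"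
      show "F (\<lambda>j. v j d) = F (\<lambda>j. K j (\<lambda>p. \<kappa> (snd p) d))"
        by (rule idx_ops_eq[OF F _ KC(2)[OF d], symmetric]) (simp add: K(3) d)
    qed
    moreover have "(\<lambda>x. F (\<lambda>j. K j x)) \<in> idx_ops (off_diag A)"
      by (rule idx_ops_comp[OF F]) (use K(1) finite_off_diag[OF fin] in auto)
    ultimately show ?thesis using HI[of "\<lambda>x. F (\<lambda>j. K j x)"] by simp
  qed
  have no_loop': "\<not> conj_on Q u v" if uv: "(u, v) \<in> H" for u v
  proof -
    obtain F where F': "F \<in> idx_ops (off_diag A) \<and> u = (\<lambda>d\<in>Q. F (\<lambda>p. \<kappa> (fst p) d)) \<and>
      v = (\<lambda>d\<in>Q. F (\<lambda>p. \<kappa> (snd p) d))"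
      using HE[OF uv] ..
    then have F: "F \<in> idx_ops (off_diag A)" "u = (\<lambda>d\<in>Q. F (\<lambda>p. \<kappa> (fst p) d))"
      "v = (\<lambda>d\<in>Q. F (\<lambda>p. \<kappa> (snd p) d))" by simp_all
    have "\<not> conj_on Q (\<lambda>d. F (\<lambda>p. \<kappa> (fst p) d)) (\<lambda>d. F (\<lambda>p. \<kappa> (snd p) d))"
    proof
      assume "conj_on Q (\<lambda>d. F (\<lambda>p. \<kappa> (fst p) d)) (\<lambda>d. F (\<lambda>p. \<kappa> (snd p) d))"
      then have "\<exists>F\<in>idx_ops (off_diag A). conj_on Q (\<lambda>d. F (\<lambda>p. \<kappa> (fst p) d)) (\<lambda>d. F (\<lambda>p. \<kappa> (snd p) d))"
        by (rule bexI[where x = F, OF _ F(1)])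
      with no_loop show False by (rule notE)
    qed
    then show ?thesis using F(2,3) unfolding conj_on_def by simp
  qed
  have inv_C: "v \<in> Q \<rightarrow>\<^sub>E C" if "inv S" "v \<in> S" for S v
    using conjunct1[OF that(1)[unfolded inv_def]] that(2) by (rule subsetD)
  have inv_act: "act F v \<in> S"
    if "inv S" "F \<in> idx_ops J" "\<And>j. j \<in> J \<Longrightarrow> v j \<in> S" for S v F and J :: "'j set"
    using conjunct2[OF that(1)[unfolded inv_def], rule_format, OF that(2,3)] .
  have orb_fin: "finite (orb Q ` S)" if "inv S" for S
  proof (rule finite_subset[OF _ finite_orbs[OF Q]], rule image_mono, rule subsetI)
    show "v \<in> Q \<rightarrow> C" if "v \<in> S" for v using inv_C[OF \<open>inv S\<close> that] by (simp add: PiE_def)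
  qed
  let ?P = "\<lambda>S. inv S \<and> (\<exists>e. clique e S)"
  have "inv (Q \<rightarrow>\<^sub>E C)"
    unfolding inv_def
  proof (intro conjI allI impI subset_refl)
    fix J :: "'j set" and F v assume F: "F \<in> idx_ops J" and v: "\<forall>j\<in>J. v j \<in> Q \<rightarrow>\<^sub>E C"
    have "F (\<lambda>j. v j d) \<in> C" if "d \<in> Q" for d
      by (rule idx_ops_closed[OF F]) (use v that in \<open>auto simp: PiE_iff\<close>)
    then show "act F v \<in> Q \<rightarrow>\<^sub>E C" by (simp add: act_def)
  qed
  moreover have "clique (\<lambda>i. restrict (\<kappa> i) Q) (Q \<rightarrow>\<^sub>E C)"
  proof -
    have "(restrict (\<kappa> i) Q, restrict (\<kappa> i') Q) \<in> H" if "i \<in> A" "i' \<in> A" "i \<noteq> i'" for i i'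
    proof -
      have "(\<lambda>x. x (i, i')) \<in> idx_ops (off_diag A)"
        using that by (intro idx_ops_proj finite_off_diag fin) (auto simp: off_diag_def)
      from HI[OF this] show ?thesis by simp
    qed
    then show ?thesis unfolding clique_def using \<kappa>C by auto
  qed
  ultimately have "?P (Q \<rightarrow>\<^sub>E C)" by blast
  \<comment> \<open>Invariant sets may be infinite, so they are measured by the number of their
    orbits.\<close>
  from ex_has_least_nat[of ?P, OF this, of "\<lambda>S. card (orb Q ` S)"]
  obtain U e where U: "inv U" "clique e U"
    and min: "\<And>S e. inv S \<Longrightarrow> clique e S \<Longrightarrow> card (orb Q ` U) \<le> card (orb Q ` S)" by blast
  have UC: "v \<in> Q \<rightarrow>\<^sub>E C" if "v \<in> U" for v
    using inv_C[OF U(1) that] .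
  have U_act: "act F v \<in> U" if "F \<in> idx_ops J" "\<And>j. j \<in> J \<Longrightarrow> v j \<in> U" for F J v
    using inv_act[OF U(1) that] .
  have eU: "e i \<in> U" if "i \<in> A" for i using U(2) that by (auto simp: clique_def)
  have eH: "(e i, e i') \<in> H" if "i \<in> A" "i' \<in> A" "i \<noteq> i'" for i i'
    using U(2) that by (auto simp: clique_def)
  have eC: "e i \<in> Q \<rightarrow> C" if "i \<in> A" for i using UC[OF eU[OF that]] by (auto simp: PiE_def)
  obtain J :: "'j set" and F \<rho> \<rho>'
    where R: "F \<in> idx_ops J \<and>
        (\<forall>j\<in>J. inj_on (\<lambda>i. \<rho> i j) A \<and> (\<lambda>i. \<rho> i j) ` A \<subseteq> A \<and> (\<lambda>i. \<rho>' i j) ` A \<subset> A) \<and>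
        (\<forall>i\<in>A. conj_on Q (\<lambda>d. F (\<lambda>j. e (\<rho> i j) d)) (\<lambda>d. F (\<lambda>j. e (\<rho>' i j) d)))"
    by (rule exE[OF rows[OF Q, of e]], erule eC, elim exE, rule that)
  then have F: "F \<in> idx_ops J" ..
  have \<rho>: "inj_on (\<lambda>i. \<rho> i j) A" "(\<lambda>i. \<rho>' i j) ` A \<subset> A" if "j \<in> J" for j
    using R that by simp_all
  have \<rho>A: "\<rho> i j \<in> A" if "i \<in> A" "j \<in> J" for i j
    using R that by (simp add: image_subset_iff)
  have conj: "conj_on Q (\<lambda>d. F (\<lambda>j. e (\<rho> i j) d)) (\<lambda>d. F (\<lambda>j. e (\<rho>' i j) d))" if "i \<in> A" for i
    using R that by simp
  define T T' where "T i = act F (\<lambda>j. e (\<rho> i j))" and "T' i = act F (\<lambda>j. e (\<rho>' i j))" for i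
  \<comment> \<open>Choose \<open>\<zeta> j\<close> outside the \<rho>'-column \<open>j\<close>.
    Then \<open>e (\<zeta> j)\<close> is adjacent to \<open>e (\<rho>' i j)\<close> for all
    \<open>i\<close> and \<open>j\<close>, and applying \<open>F\<close> makes \<open>z\<close>
    adjacent to every \<open>T' i\<close>.\<close>
  have "\<forall>j\<in>J. \<exists>c. c \<in> A \<and> (\<forall>i\<in>A. \<rho>' i j \<noteq> c)" using \<rho>(2) by blast
  from bchoice[OF this] obtain \<zeta> where "\<forall>j\<in>J. \<zeta> j \<in> A \<and> (\<forall>i\<in>A. \<rho>' i j \<noteq> \<zeta> j)" ..
  then have \<zeta>: "\<zeta> j \<in> A" "i \<in> A \<Longrightarrow> \<rho>' i j \<noteq> \<zeta> j" if "j \<in> J" for i j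
    using that by blast+
  define z where "z = act F (\<lambda>j. e (\<zeta> j))"
  have TU: "T i \<in> U" if "i \<in> A" for i
    unfolding T_def using \<rho>A that eU by (intro U_act[OF F]) auto
  have \<rho>': "\<rho>' i j \<in> A" if "i \<in> A" "j \<in> J" for i j using \<rho>(2) that by blast
  have T'U: "T' i \<in> U" if "i \<in> A" for i
    unfolding T'_def using \<rho>' that eU by (intro U_act[OF F]) auto
  have zU: "z \<in> U" unfolding z_def using \<zeta>(1) eU by (intro U_act[OF F]) auto
  have TH: "(T i, T i') \<in> H" if "i \<in> A" "i' \<in> A" "i \<noteq> i'" for i i'
    unfolding T_def using that \<rho>(1) \<rho>A by (intro H_inv[OF F] eH) (auto simp: inj_on_def)
  have zH: "(z, T' i) \<in> H" if "i \<in> A" for i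
    unfolding T'_def z_def using that \<rho>' \<zeta> by (intro H_inv[OF F] eH) (auto simp: eq_commute)
  have fC: "v \<in> Q \<rightarrow> C" if "v \<in> U" for v using UC[OF that] by (auto simp: PiE_def)
  \<comment> \<open>The part of \<open>U\<close> that is reached by an edge from the orbit of
    \<open>z\<close>.\<close>
  let ?U' = "{v \<in> U. \<exists>w \<in> Q \<rightarrow>\<^sub>E C. conj_on Q z w \<and> (w, v) \<in> H}"
  \<comment> \<open>A group element takes \<open>T' i\<close> to \<open>T i\<close>; applied to the
    edge from \<open>z\<close> to \<open>T' i\<close> it gives an edge from the orbit of
    \<open>z\<close> to \<open>T i\<close>.\<close>
  have TU': "T i \<in> ?U'" if i: "i \<in> A" for i
  proof -
    have "conj_on Q (T i) (T' i)" using conj[OF i] by (simp add: T_def T'_def act_def conj_on_def)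
    then have "conj_on Q (T' i) (T i)" by (rule conj_on_sym[OF fC[OF TU[OF i]]])
    then obtain \<alpha> where \<alpha>: "\<alpha> \<in> G" "\<forall>d\<in>Q. T i d = \<alpha> (T' i d)" by (auto simp: conj_on_def)
    \<comment> \<open>Any element of \<open>'j\<close> serves as the single index that presents
      \<alpha> as an operation.\<close>
    define j0 :: 'j where "j0 = undefined"
    have a: "(\<lambda>x. \<alpha> (x j0)) \<in> idx_ops {j0}"
      using \<alpha>(1) by (intro unary_part_idx_ops G_unary) auto
    have "T i = act (\<lambda>x. \<alpha> (x j0)) (\<lambda>_. T' i)"
      using \<alpha>(2) UC[OF TU[OF i]] by (auto simp: act_def fun_eq_iff PiE_iff extensional_def)
    then have "(act (\<lambda>x. \<alpha> (x j0)) (\<lambda>_. z), T i) \<in> H"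
      using H_inv[OF a, of "\<lambda>_. z" "\<lambda>_. T' i"] zH[OF i] by simp
    moreover have "conj_on Q z (act (\<lambda>x. \<alpha> (x j0)) (\<lambda>_. z))"
      using \<alpha>(1) by (auto simp: conj_on_def act_def)
    ultimately show ?thesis using TU[OF i] H_C by blast
  qed
  have "inv ?U'"
    unfolding inv_def
  proof (intro conjI allI impI)
    show "?U' \<subseteq> (Q \<rightarrow>\<^sub>E C)" using UC by blast
    fix L :: "'j set" and K v assume K: "K \<in> idx_ops L" and v: "\<forall>j\<in>L. v j \<in> ?U'"
    have "\<forall>j\<in>L. \<exists>w. conj_on Q z w \<and> (w, v j) \<in> H" using v by blast
    from bchoice[OF this] obtain w where w: "\<forall>j\<in>L. conj_on Q z (w j) \<and> (w j, v j) \<in> H" ..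
    have "(act K w, act K v) \<in> H" using w by (intro H_inv[OF K]) auto
    moreover have "conj_on Q z (act K w)"
      using conj_on_idx_ops[OF K _ fC[OF zU] Q, of w] w by (simp add: act_def conj_on_def)
    moreover have "act K v \<in> U" using v by (intro U_act[OF K]) auto
    ultimately show "act K v \<in> ?U'" using H_C by blast
  qed
  moreover have "clique T ?U'" using TU' TH by (auto simp: clique_def)
  ultimately have "card (orb Q ` U) \<le> card (orb Q ` ?U')" by (rule min)
  moreover have "orb Q ` ?U' \<subset> orb Q ` U"
  proof -
    \<comment> \<open>Otherwise some edge would run from the orbit of \<open>z\<close> into that
      same orbit, which is a loop modulo \<open>G\<close>.\<close>
    have "orb Q z \<notin> orb Q ` ?U'"
    proof
      assume "orb Q z \<in> orb Q ` ?U'"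
      then obtain v w where v: "v \<in> U" "orb Q z = orb Q v" and w: "conj_on Q z w" "(w, v) \<in> H"
        by blast
      have "conj_on Q z v" using orb_eqD[OF fC[OF zU] UC[OF v(1)] v(2)] .
      moreover have "w \<in> Q \<rightarrow> C" using H_C[OF w(2)] by (simp add: PiE_def)
      ultimately have "conj_on Q w v"
        using conj_on_trans[OF _ conj_on_sym[OF fC[OF zU] w(1)]] by blast
      then show False using no_loop'[OF w(2)] by (rule notE[rotated])
    qed
    then show ?thesis using zU by blast
  qed
  from psubset_card_mono[OF orb_fin[OF U(1)] this]
  have "card (orb Q ` ?U') < card (orb Q ` U)" .
  ultimately show False by linarith
qed

section \<open>Lowering the number of vertices\<close>

lemma loop_cond_mono:
  assumes A: "loop_cond A" and f: "inj_on f A" "f ` A \<subseteq> B" and B: "finite B"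
  shows "loop_cond B"
  unfolding loop_cond_def
proof (intro allI impI)
  fix Q :: "nat set" and e assume Q: "finite Q" and e: "\<forall>i\<in>B. e i \<in> Q \<rightarrow> C"
  have "\<forall>i\<in>A. e (f i) \<in> Q \<rightarrow> C" using e f(2) by blast
  then obtain F where F: "F \<in> idx_ops (off_diag A)"
    "conj_on Q (\<lambda>d. F (\<lambda>p. e (f (fst p)) d)) (\<lambda>d. F (\<lambda>p. e (f (snd p)) d))"
    using A[unfolded loop_cond_def, rule_format, of Q "\<lambda>i. e (f i)"] Q by auto
  let ?F = "\<lambda>x. F (\<lambda>p. x (f (fst p), f (snd p)))"
  have "(\<lambda>p. (f (fst p), f (snd p))) \<in> off_diag A \<rightarrow> off_diag B"
    using f by (auto simp: off_diag_def inj_on_def)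
  from idx_ops_minor[OF F(1) this finite_off_diag[OF B]]
  have "?F \<in> idx_ops (off_diag B)" .
  moreover have "conj_on Q (\<lambda>d. ?F (\<lambda>p. e (fst p) d)) (\<lambda>d. ?F (\<lambda>p. e (snd p) d))"
    using F(2) by simp
  ultimately show "\<exists>F\<in>idx_ops (off_diag B). conj_on Q (\<lambda>d. F (\<lambda>p. e (fst p) d)) (\<lambda>d. F (\<lambda>p. e (snd p) d))"
    by (rule bexI[where x = ?F, rotated])
qed

text \<open>Recolouring: rows are permutations \<open>b v\<close> of \<open>B\<close>, one for each \<open>v \<in> A\<close>. An operation for \<open>A\<close>
  identifies the choice of the first vertex of an edge with the choice of the second one, which is used
  only in the rows outside \<open>P\<close>.\<close>

lemma loop_cond_transfer:
  fixes B :: "nat set"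
  assumes A: "loop_cond A" and B: "finite B"
    and b: "\<And>v. v \<in> A \<Longrightarrow> inj_on (b v) B \<and> b v ` B \<subseteq> B"
    and P: "\<And>v v'. v \<in> A \<Longrightarrow> v' \<in> A \<Longrightarrow> v \<noteq> v' \<Longrightarrow> (\<lambda>i. if i \<in> P then b v i else b v' i) ` B \<noteq> B"
  shows "loop_cond B"
proof (rule loop_condI[OF B])
  fix Q :: "nat set" and e :: "nat \<Rightarrow> nat \<Rightarrow> 'a"
  assume Q: "finite Q" and e: "\<And>i. i \<in> B \<Longrightarrow> e i \<in> Q \<rightarrow> C"
  \<comment> \<open>All rows \<open>b v i\<close> with \<open>i\<close> in \<open>B\<close> are
    concatenated into one tuple on \<open>B \<times> Q\<close>, encoded in the naturals, so that a
    single \<alpha> serves every row.\<close>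
  define e' where "e' v d = e (b v (fst (prod_decode d))) (snd (prod_decode d))" for v d
  have bB: "b v i \<in> B" if "v \<in> A" "i \<in> B" for v i using b that by blast
  have "finite (prod_encode ` (B \<times> Q))" "\<forall>v\<in>A. e' v \<in> prod_encode ` (B \<times> Q) \<rightarrow> C"
    using B Q e bB by (auto simp: e'_def Pi_iff)
  then obtain F where F: "F \<in> idx_ops (off_diag A)"
    and c: "conj_on (prod_encode ` (B \<times> Q)) (\<lambda>d. F (\<lambda>p. e' (fst p) d)) (\<lambda>d. F (\<lambda>p. e' (snd p) d))"
    using A unfolding loop_cond_def by blast
  from c obtain \<alpha> where \<alpha>: "\<alpha> \<in> G"
    "\<forall>d\<in>prod_encode ` (B \<times> Q). F (\<lambda>p. e' (snd p) d) = \<alpha> (F (\<lambda>p. e' (fst p) d))"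
    unfolding conj_on_def by blast
  define \<rho> where "\<rho> i p = b (fst p) i" for i and p :: "'b \<times> 'b"
  define \<rho>' where "\<rho>' i p = (if i \<in> P then b (fst p) i else b (snd p) i)" for i and p :: "'b \<times> 'b"
  have rows: "inj_on (\<lambda>i. \<rho> i p) B \<and> (\<lambda>i. \<rho> i p) ` B \<subseteq> B \<and> (\<lambda>i. \<rho>' i p) ` B \<subset> B" if "p \<in> off_diag A" for p
  proof -
    have p: "fst p \<in> A" "snd p \<in> A" "fst p \<noteq> snd p" using that by (auto simp: off_diag_def)
    have "(\<lambda>i. \<rho>' i p) ` B \<subseteq> B" using bB p by (auto simp: \<rho>'_def)
    moreover have "(\<lambda>i. \<rho>' i p) ` B \<noteq> B" using P[OF p] by (simp add: \<rho>'_def)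
    ultimately show ?thesis using b[OF p(1)] by (auto simp: \<rho>_def)
  qed
  have conj: "conj_on Q (\<lambda>d. F (\<lambda>p. e (\<rho> i p) d)) (\<lambda>d. F (\<lambda>p. e (\<rho>' i p) d))" if i: "i \<in> B" for i
  proof (cases "i \<in> P")
    case True
    have "(\<lambda>d. F (\<lambda>p. e (b (fst p) i) d)) \<in> Q \<rightarrow> C"
    proof
      fix d assume "d \<in> Q"
      show "F (\<lambda>p. e (b (fst p) i) d) \<in> C"
        by (rule idx_ops_closed[OF F]) (use bB i e \<open>d \<in> Q\<close> in \<open>auto simp: off_diag_def Pi_iff\<close>)
    qed
    then show ?thesis using True by (simp add: \<rho>_def \<rho>'_def conj_on_refl)
  next
    case False
    have "F (\<lambda>p. e (b (snd p) i) d) = \<alpha> (F (\<lambda>p. e (b (fst p) i) d))" if "d \<in> Q" for d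
      using \<alpha>(2)[rule_format, of "prod_encode (i, d)"] i that by (simp add: e'_def)
    then show ?thesis using False \<alpha>(1) by (auto simp: \<rho>_def \<rho>'_def conj_on_def)
  qed
  show "\<exists>(J :: ('b \<times> 'b) set) F \<rho> \<rho>'. F \<in> idx_ops J \<and>
        (\<forall>j\<in>J. inj_on (\<lambda>i. \<rho> i j) B \<and> (\<lambda>i. \<rho> i j) ` B \<subseteq> B \<and> (\<lambda>i. \<rho>' i j) ` B \<subset> B) \<and>
        (\<forall>i\<in>B. conj_on Q (\<lambda>d. F (\<lambda>j. e (\<rho> i j) d)) (\<lambda>d. F (\<lambda>j. e (\<rho>' i j) d)))"
    by (rule exI[of _ "off_diag A"], rule exI[of _ F], rule exI[of _ \<rho>], rule exI[of _ \<rho>'])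
      (intro conjI[OF F conjI] ballI, erule rows, erule conj)
qed

text \<open>Distinct \<open>v\<close> and \<open>v'\<close> differ in a binary digit
  \<open>l\<close>. In the mixed column the even entry \<open>2 * l\<close> follows \<open>v\<close>
  and the odd entry follows \<open>v'\<close>, so exactly one of them is swapped and both take the
  same value; the other value \<open>k\<close> of the pair is missed.\<close>

lemma loop_cond_double_log:
  fixes n :: nat
  assumes "loop_cond {..<n}" and n: "n \<le> 2 ^ L"
  shows "loop_cond {..<2 * L}"
proof -
  \<comment> \<open>\<open>b v\<close> swaps the pair \<open>{2 * l, 2 * l + 1}\<close> if the \<open>l\<close>-th binary digit of \<open>v\<close> is set.\<close>
  define b where "b v i = (if bit v (i div 2) then if even i then Suc i else i - 1 else i)" for v i :: nat
  have div: "b v i div 2 = i div 2" for v i by (auto simp: b_def elim: oddE)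
  have b_lt: "b v i < 2 * L" if "i < 2 * L" for v i
    using that div[of v i] by (metis div_less_iff_less_mult mult.commute zero_less_numeral)
  have inj: "inj_on (b v) {..<2 * L}" for v
  proof (rule inj_onI)
    fix i j assume "b v i = b v j"
    moreover from this have "i div 2 = j div 2" using div by metis
    ultimately show "i = j" by (auto simp: b_def split: if_splits elim!: evenE oddE)
  qed
  show ?thesis
  proof (rule loop_cond_transfer[OF assms(1), where b = b and P = "Collect even"])
    fix v v' assume v: "v \<in> {..<n}" "v' \<in> {..<n}" "v \<noteq> v'"
    have "\<exists>l<L. bit v l \<noteq> bit v' l"
    proof (rule ccontr)
      assume a: "\<not> ?thesis"
      have "take_bit L v = take_bit L v'" by (rule bit_eqI) (use a in \<open>auto simp: bit_take_bit_iff\<close>)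
      moreover have "take_bit L v = v" "take_bit L v' = v'" using v n by (simp_all add: take_bit_nat_eq_self_iff)
      ultimately show False using v(3) by simp
    qed
    then obtain l where l: "l < L" "bit v l \<noteq> bit v' l" by blast
    define k where "k = (if bit v l then 2 * l else Suc (2 * l))"
    let ?h = "\<lambda>i. if i \<in> Collect even then b v i else b v' i"
    have "k \<notin> ?h ` {..<2 * L}"
    proof (rule notI, erule imageE)
      fix i assume eq': "k = ?h i"
      then have eq: "?h i = k" by (rule sym)
      have "i div 2 = ?h i div 2" by (simp add: div)
      also have "\<dots> = l" unfolding eq by (simp add: k_def)
      finally consider "i = 2 * l" | "i = Suc (2 * l)" by linarith
      then show False using eq l(2) by cases (simp_all add: k_def b_def split: if_splits)
    qed
    moreover have "k \<in> {..<2 * L}" using l(1) by (simp add: k_def)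
    ultimately show "?h ` {..<2 * L} \<noteq> {..<2 * L}" by (rule_tac notI, simp only: not_True_eq_False)
  qed (use b_lt inj in auto)
qed

text \<open>Above 6 the double logarithm bound removes at least one vertex. The inequality
  \<open>2 * L + 2 \<le> 2 ^ L\<close> needs \<open>L\<close> to be at least 3, hence the stop at
  6.\<close>

lemma loop_cond_6:
  fixes n :: nat
  assumes "loop_cond {..<n}"
  shows "loop_cond {..<6::nat}"
  using assms
proof (induction n)
  case 0
  then show ?case by (rule loop_cond_mono[where f = id]) auto
next
  case (Suc n)
  show ?case
  proof (cases "Suc n \<le> 6")
    case True
    then show ?thesis by (intro loop_cond_mono[OF Suc.prems, where f = id]) auto
  next
    case False
    have pow: "2 * L + 2 \<le> 2 ^ L" if "3 \<le> L" for L :: nat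
      using that by (induction L rule: dec_induct) auto
    have "Suc n \<le> 2 * (n div 2) + 2" by simp
    also have "\<dots> \<le> 2 ^ (n div 2)" using False by (intro pow) auto
    finally have "loop_cond {..<2 * (n div 2)}" by (rule loop_cond_double_log[OF Suc.prems])
    then have "loop_cond {..<n}" by (rule loop_cond_mono[where f = id]) auto
    then show ?thesis by (rule Suc.IH)
  qed
qed

text \<open>The six vertices are the 2-subsets of a 4-element set. A mixed column lists a 2-subset
  and then the complement of a different one; these two pairs intersect, so a value is repeated and
  the column is not onto.\<close>

lemma loop_cond_4:
  assumes "loop_cond {..<6::nat}"
  shows "loop_cond {..<4::nat}"
proof -
  \<comment> \<open>The first two entries run through the 2-subsets of \<open>{0, 1, 2, 3}\<close>, the last two are the complements.\<close>
  define b :: "nat \<Rightarrow> nat \<Rightarrow> nat" where "b v i =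
    [[0,1,2,3], [0,2,1,3], [0,3,1,2], [1,2,0,3], [1,3,0,2], [2,3,0,1]] ! v ! i" for v i
  have four: "{..<4::nat} = set [0, 1, 2, 3]" and six: "{..<6::nat} = set [0, 1, 2, 3, 4, 5]" by auto
  show ?thesis
    unfolding four
  proof (rule loop_cond_transfer[OF assms[unfolded six], where b = b and P = "set [0, 1]"])
    have "\<forall>v\<in>set [0, 1, 2, 3, 4, 5]. inj_on (b v) (set [0, 1, 2, 3]) \<and> b v ` set [0, 1, 2, 3] \<subseteq> set [0, 1, 2, 3]"
      unfolding b_def by code_simp
    then show "inj_on (b v) (set [0, 1, 2, 3]) \<and> b v ` set [0, 1, 2, 3] \<subseteq> set [0, 1, 2, 3]"
      if "v \<in> set [0, 1, 2, 3, 4, 5]" for v using that ..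
    have *: "\<forall>v\<in>set [0, 1, 2, 3, 4, 5]. \<forall>v'\<in>set [0, 1, 2, 3, 4, 5]. v \<noteq> v' \<longrightarrow>
        (\<lambda>i. if i \<in> set [0, 1] then b v i else b v' i) ` set [0, 1, 2, 3] \<noteq> set [0, 1, 2, 3]"
      unfolding b_def by code_simp
    show "(\<lambda>i. if i \<in> set [0, 1] then b v i else b v' i) ` set [0, 1, 2, 3] \<noteq> set [0, 1, 2, 3]"
      if "v \<in> set [0, 1, 2, 3, 4, 5]" "v' \<in> set [0, 1, 2, 3, 4, 5]" "v \<noteq> v'" for v v'
      by (rule *[THEN bspec, THEN bspec, THEN mp]) (fact that)+
  qed simp
qed

end

section \<open>Non-trivial h1 identities\<close>

text \<open>Compactness: the choices of one coordinate per symbol form a product of finite discrete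
  spaces, in which each identity defines a closed set. If all finite subsets were solvable by
  projections, so would be \<open>E\<close>.\<close>

lemma finite_non_trivial_h1:
  fixes E :: "'s h1_identity set"
  assumes E: "h1_identities_over \<Omega> ar E" and nt: "non_trivial_h1 \<Omega> ar E"
  shows "\<exists>E\<^sub>0\<subseteq>E. finite E\<^sub>0 \<and> \<not> (\<exists>p. (\<forall>s\<in>\<Omega>. p s < ar s) \<and> (\<forall>((f, xs), (g, ys))\<in>E\<^sub>0. xs ! p f = ys ! p g))"
proof (rule ccontr)
  assume "\<not> ?thesis"
  then have fin: "\<exists>p. (\<forall>s\<in>\<Omega>. p s < ar s) \<and> (\<forall>((f, xs), (g, ys))\<in>E\<^sub>0. xs ! p f = ys ! p g)"
    if "E\<^sub>0 \<subseteq> E" "finite E\<^sub>0" for E\<^sub>0 using that by auto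
  define X where "X = product_topology (\<lambda>s. discrete_topology {..<ar s}) \<Omega>"
  have X: "topspace X = (\<Pi>\<^sub>E s\<in>\<Omega>. {..<ar s})" by (simp add: X_def)
  have "compact_space X"
    unfolding X_def by (auto simp: compact_space_product_topology compact_space_discrete_topology)
  define K :: "'s h1_identity \<Rightarrow> ('s \<Rightarrow> nat) set"
    where "K = (\<lambda>((f, xs), (g, ys)). {p \<in> topspace X. xs ! p f = ys ! p g})"
  have "closedin X (K n)" if n: "n \<in> E" for n
  proof -
    obtain f xs g ys where n': "n = ((f, xs), (g, ys))" by (metis surj_pair)
    have fg: "f \<in> \<Omega>" "g \<in> \<Omega>" using E n n' by (auto simp: h1_identities_over_def)
    have cl: "closedin X {p \<in> topspace X. p s = i}" if "s \<in> \<Omega>" "i < ar s" for s i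
    proof -
      have "continuous_map X (discrete_topology {..<ar s}) (\<lambda>p. p s)"
        unfolding X_def using that(1) by (rule continuous_map_product_projection)
      from closedin_continuous_map_preimage[OF this, of "{i}"] that(2) show ?thesis by simp
    qed
    \<comment> \<open>An identity constrains the choice only at \<open>f\<close> and
      \<open>g\<close>, which leaves finitely many pairs of values.\<close>
    have "K n = (\<Union>(i, j)\<in>{(i, j). i < ar f \<and> j < ar g \<and> xs ! i = ys ! j}.
        {p \<in> topspace X. p f = i} \<inter> {p \<in> topspace X. p g = j})"
      using fg by (auto simp: K_def n' X PiE_iff)
    also have "closedin X \<dots>"
    proof (rule closedin_Union)
      show "finite ((\<lambda>(i, j). {p \<in> topspace X. p f = i} \<inter> {p \<in> topspace X. p g = j}) `
          {(i, j). i < ar f \<and> j < ar g \<and> xs ! i = ys ! j})"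
        by (rule finite_imageI, rule finite_subset[of _ "{..<ar f} \<times> {..<ar g}"]) auto
    qed (use fg cl in auto)
    finally show ?thesis .
  qed
  \<comment> \<open>The whole space is added to the family so that the common point lies in it even
    when \<open>E\<close> is empty.\<close>
  moreover have "\<Inter>\<F> \<noteq> {}" if \<F>: "finite \<F>" "\<F> \<subseteq> insert (topspace X) (K ` E)" for \<F>
  proof -
    have "finite (\<F> - {topspace X})" "\<F> - {topspace X} \<subseteq> K ` E" using \<F> by auto
    then obtain E\<^sub>0 where E\<^sub>0: "E\<^sub>0 \<subseteq> E" "finite E\<^sub>0" "\<F> - {topspace X} = K ` E\<^sub>0"
      by (meson finite_subset_image)
    obtain p where p: "\<forall>s\<in>\<Omega>. p s < ar s" "\<forall>((f, xs), (g, ys))\<in>E\<^sub>0. xs ! p f = ys ! p g"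
      using fin[OF E\<^sub>0(1,2)] by auto
    have pX: "restrict p \<Omega> \<in> topspace X" using p(1) by (simp add: X)
    have "restrict p \<Omega> \<in> K n" if n: "n \<in> E\<^sub>0" for n
    proof -
      obtain f xs g ys where n': "n = ((f, xs), (g, ys))" by (metis surj_pair)
      have "f \<in> \<Omega>" "g \<in> \<Omega>" using E E\<^sub>0(1) n n' by (auto simp: h1_identities_over_def)
      moreover have "xs ! p f = ys ! p g" using p(2) n n' by auto
      ultimately show ?thesis using pX by (simp add: K_def n')
    qed
    then have "restrict p \<Omega> \<in> \<Inter>\<F>" using E\<^sub>0(3) pX by blast
    then show ?thesis by blast
  qed
  ultimately have "\<Inter>(insert (topspace X) (K ` E)) \<noteq> {}"
    using \<open>compact_space X\<close>[unfolded compact_space_fip, rule_format, of "insert (topspace X) (K ` E)"]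
    by blast
  then obtain p where p: "p \<in> topspace X" "\<forall>n\<in>E. p \<in> K n" by auto
  have "\<forall>s\<in>\<Omega>. p s < ar s" using p(1) by (auto simp: X PiE_iff)
  moreover have "\<forall>((f, xs), (g, ys))\<in>E. xs ! p f = ys ! p g" using p(2) by (fastforce simp: K_def)
  ultimately have "satisfies_h1 (UNIV :: bool set) (projection_clone UNIV) \<Omega> ar E"
    using satisfies_h1_projection_clone[OF E, of True UNIV False] by blast
  then show False using nt by (simp add: non_trivial_h1_def)
qed

context oligomorphic_core
begin

text \<open>\<open>F\<close> is the star composition of the operations \<open>I s\<close>, each made idempotent on \<open>S\<close> by an element
  of \<open>G\<close> beforehand.\<close>

lemma star_composition:
  fixes I :: "'s \<Rightarrow> 'a operation"
  assumes S: "finite S" "S \<subseteq> C" and "finite \<Sigma>" and "\<And>s. s \<in> \<Sigma> \<Longrightarrow> (ar s, I s) \<in> \<C>"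
  shows "\<exists>(J :: nat set) F c. F \<in> idx_ops J \<and> (\<forall>k\<in>S. F (\<lambda>_. k) = k) \<and>
    (\<forall>s\<in>\<Sigma>. (\<forall>j\<in>J. c s j < ar s) \<and>
      (\<exists>\<alpha>\<in>G. \<forall>y\<in>{..<ar s} \<rightarrow>\<^sub>E S. F (\<lambda>j. y (c s j)) = \<alpha> (I s y)))"
  using assms(3,4)
proof (induction \<Sigma>)
  case empty
  have "(\<lambda>x. x 0) \<in> idx_ops {0 :: nat}" by (rule idx_ops_proj) auto
  then show ?case by (rule_tac x = "{0}" in exI, rule_tac x = "\<lambda>x. x 0" in exI) simp
next
  case (insert a \<Sigma>)
  then obtain J :: "nat set" and F c where F: "F \<in> idx_ops J" and Fk: "\<forall>k\<in>S. F (\<lambda>_. k) = k"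
    and c: "\<forall>s\<in>\<Sigma>. (\<forall>j\<in>J. c s j < ar s) \<and>
      (\<exists>\<alpha>\<in>G. \<forall>y\<in>{..<ar s} \<rightarrow>\<^sub>E S. F (\<lambda>j. y (c s j)) = \<alpha> (I s y))"
    by (metis insertCI)
  define n where "n = ar a"
  define h where "h = (\<lambda>x. I a (restrict x {..<n}))"
  have h: "h \<in> idx_ops {..<n}"
    unfolding h_def n_def by (intro idx_ops_op insert.prems) simp
  obtain \<gamma> where \<gamma>: "\<gamma> \<in> G" "\<forall>k\<in>S. h (\<lambda>_. k) = \<gamma> k"
    using unary_approx[OF idx_ops_unary_part[OF h] S] S(2) by (auto simp: subset_iff)
  obtain \<beta> where \<beta>: "\<beta> \<in> G" "\<forall>k\<in>C. \<beta> (\<gamma> k) = k" using G_inv[OF \<gamma>(1)] by auto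
  define g where "g x = \<beta> (h x)" for x
  have g: "g \<in> idx_ops {..<n}"
    unfolding g_def[abs_def]
    by (rule idx_ops_comp[OF unary_part_idx_ops[OF G_unary[OF \<beta>(1)], of "{()}" "()"]]) (use h in auto)
  have gk: "g (\<lambda>_. k) = k" if "k \<in> S" for k using that \<gamma> \<beta> S(2) by (auto simp: g_def)
  define J' where "J' = prod_encode ` ({..<n} \<times> J)"
  define F' where "F' x = g (\<lambda>i. F (\<lambda>j. x (prod_encode (i, j))))" for x
  \<comment> \<open>An argument of \<open>F'\<close> encodes a position in \<open>g\<close> and an
    argument of \<open>F\<close>; the new symbol reads the former, the earlier symbols the
    latter.\<close>
  define c' where "c' s j = (if s = a then fst (prod_decode j) else c s (snd (prod_decode j)))" for s j
  have J: "finite J" using idx_ops_finite[OF F] by simp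
  have "finite J'" using J by (simp add: J'_def)
  have F': "F' \<in> idx_ops J'"
    unfolding F'_def[abs_def]
    by (rule idx_ops_comp[OF g idx_ops_minor[OF F]]) (use J in \<open>auto simp: J'_def\<close>)
  have "F' (\<lambda>_. k) = k" if "k \<in> S" for k using that Fk gk by (simp add: F'_def)
  moreover have "(\<forall>j\<in>J'. c' s j < ar s) \<and>
      (\<exists>\<alpha>\<in>G. \<forall>y\<in>{..<ar s} \<rightarrow>\<^sub>E S. F' (\<lambda>j. y (c' s j)) = \<alpha> (I s y))" if s: "s \<in> insert a \<Sigma>" for s
  proof (cases "s = a")
    case True
    have "F' (\<lambda>j. y (c' s j)) = \<beta> (I s y)" if y: "y \<in> {..<ar s} \<rightarrow>\<^sub>E S" for y
    proof -
      have yS: "y i \<in> S" if "i < n" for i using y that True by (auto simp: n_def)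
      have "F' (\<lambda>j. y (c' s j)) = g (\<lambda>i. F (\<lambda>_. y i))" using True by (simp add: F'_def c'_def)
      also have "\<dots> = g y"
        by (rule idx_ops_eq[OF g, symmetric]) (use yS Fk S(2) in auto)
      also have "\<dots> = \<beta> (I s y)" using y True by (simp add: g_def h_def n_def PiE_restrict)
      finally show ?thesis .
    qed
    then show ?thesis using \<beta>(1) True by (auto simp: c'_def J'_def n_def)
  next
    case False
    with s have s: "s \<in> \<Sigma>" by simp
    obtain \<alpha> where \<alpha>: "\<alpha> \<in> G" "\<forall>y\<in>{..<ar s} \<rightarrow>\<^sub>E S. F (\<lambda>j. y (c s j)) = \<alpha> (I s y)"
      using c s by blast
    \<comment> \<open>These values may leave \<open>S\<close>, where \<open>g\<close> is not known
      to be idempotent. On the finite set \<open>?W\<close> its diagonal still acts like some group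
      element \<delta>, and this costs only a factor from \<open>G\<close>.\<close>
    let ?W = "(\<lambda>y. F (\<lambda>j. y (c s j))) ` ({..<ar s} \<rightarrow>\<^sub>E S)"
    have W: "finite ?W" by (intro finite_imageI finite_PiE) (use S in auto)
    have yC: "(\<lambda>j. y (c s j)) \<in> J \<rightarrow> C" if "y \<in> {..<ar s} \<rightarrow>\<^sub>E S" for y
      using that c s S(2) by (auto simp: PiE_iff)
    have WC: "?W \<subseteq> C" using idx_ops_closed[OF F yC] by auto
    obtain \<delta> where \<delta>: "\<delta> \<in> G" "\<forall>k\<in>?W. g (\<lambda>_. k) = \<delta> k"
      using unary_approx[OF idx_ops_unary_part[OF g] W WC] WC by (auto simp: subset_iff)
    obtain \<epsilon> where \<epsilon>: "\<epsilon> \<in> G" "\<forall>k\<in>C. \<epsilon> k = \<delta> (\<alpha> k)" using G_comp[OF \<delta>(1) \<alpha>(1)] by auto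
    have "F' (\<lambda>j. y (c' s j)) = \<epsilon> (I s y)" if y: "y \<in> {..<ar s} \<rightarrow>\<^sub>E S" for y
    proof -
      have "F' (\<lambda>j. y (c' s j)) = g (\<lambda>_. F (\<lambda>j. y (c s j)))" using False by (simp add: F'_def c'_def)
      also have "\<dots> = \<delta> (\<alpha> (I s y))" using \<delta>(2) \<alpha>(2) y by simp
      also have "I s y \<in> C"
        using op_mem[OF insert.prems[of s]] s y S(2) by (auto simp: tuples_def PiE_iff Pi_iff subset_iff)
      then have "\<delta> (\<alpha> (I s y)) = \<epsilon> (I s y)" using \<epsilon>(2) by simp
      finally show ?thesis .
    qed
    then show ?thesis using \<epsilon>(1) False c s by (auto simp: c'_def J'_def)
  qed
  ultimately show ?case using F' by (intro exI[of _ J'] exI[of _ F'] exI[of _ c'] conjI ballI) auto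
qed

lemma loop_cond_4_if_non_trivial_h1:
  fixes E :: "'s h1_identity set"
  assumes E: "h1_identities_over \<Omega> ar E" and nt: "non_trivial_h1 \<Omega> ar E"
    and sat: "satisfies_h1 C \<C> \<Omega> ar E"
  shows "loop_cond {..<4::nat}"
proof -
  obtain E\<^sub>0 where E\<^sub>0: "E\<^sub>0 \<subseteq> E" "finite E\<^sub>0"
    and no_p: "\<not> (\<exists>p. (\<forall>s\<in>\<Omega>. p s < ar s) \<and> (\<forall>((f, xs), (g, ys))\<in>E\<^sub>0. xs ! p f = ys ! p g))"
    using finite_non_trivial_h1[OF E nt] by auto
  obtain I where I: "\<forall>s\<in>\<Omega>. (ar s, I s) \<in> \<C>"
    "\<forall>(l, r)\<in>E. \<forall>\<sigma>\<in>UNIV \<rightarrow> C. eval_h1_term I \<sigma> l = eval_h1_term I \<sigma> r"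
    using sat unfolding satisfies_h1_def by auto
  define \<Sigma> where "\<Sigma> = (\<lambda>n. fst (fst n)) ` E\<^sub>0 \<union> (\<lambda>n. fst (snd n)) ` E\<^sub>0"
  have wf: "fst (fst n) \<in> \<Omega> \<and> fst (snd n) \<in> \<Omega> \<and> length (snd (fst n)) = ar (fst (fst n)) \<and>
      length (snd (snd n)) = ar (fst (snd n))" if "n \<in> E\<^sub>0" for n
    using bspec[OF conjunct2[OF E[unfolded h1_identities_over_def]] subsetD[OF E\<^sub>0(1) that]]
    by (simp add: split_beta)
  have \<Sigma>: "finite \<Sigma>" "\<Sigma> \<subseteq> \<Omega>"
    using E\<^sub>0(2) wf by (auto simp: \<Sigma>_def)
  \<comment> \<open>A vertex is an identity, a variable of its left side and a bit, so that one
    column can test all identities at once.\<close>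
  define A where "A = Sigma E\<^sub>0 (\<lambda>n. set (snd (fst n)) \<times> (UNIV :: bool set))"
  have A: "finite A" using E\<^sub>0(2) by (simp add: A_def)
  have "loop_cond A"
  proof (rule loop_condI[OF A])
    fix Q :: "nat set" and e :: "'s h1_identity \<times> nat \<times> bool \<Rightarrow> nat \<Rightarrow> 'a"
    assume Q: "finite Q" and e: "\<And>i. i \<in> A \<Longrightarrow> e i \<in> Q \<rightarrow> C"
    define S where "S = (\<Union>i\<in>A. e i ` Q)"
    have eC: "e i d \<in> C" if "i \<in> A" "d \<in> Q" for i d using e[OF that(1)] that(2) by (rule Pi_mem)
    have S: "finite S" unfolding S_def by (intro finite_UN_I A finite_imageI Q)
    have SC: "S \<subseteq> C" unfolding S_def by (intro UN_least image_subsetI eC)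
    have "\<exists>(J :: nat set) F c. F \<in> idx_ops J \<and> (\<forall>k\<in>S. F (\<lambda>_. k) = k) \<and>
      (\<forall>s\<in>\<Sigma>. (\<forall>j\<in>J. c s j < ar s) \<and>
        (\<exists>\<alpha>\<in>G. \<forall>y\<in>{..<ar s} \<rightarrow>\<^sub>E S. F (\<lambda>j. y (c s j)) = \<alpha> (I s y)))"
      by (rule star_composition[OF S SC \<Sigma>(1)]) (use I(1) \<Sigma>(2) in auto)
    then obtain J :: "nat set" and F c where F: "F \<in> idx_ops J"
      and c: "\<forall>s\<in>\<Sigma>. (\<forall>j\<in>J. c s j < ar s) \<and>
        (\<exists>\<alpha>\<in>G. \<forall>y\<in>{..<ar s} \<rightarrow>\<^sub>E S. F (\<lambda>j. y (c s j)) = \<alpha> (I s y))"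
      by metis
    define \<pi> where "\<pi> n j = snd (fst n) ! c (fst (fst n)) j" for n :: "'s h1_identity" and j
    define \<sigma> where "\<sigma> n j = snd (snd n) ! c (fst (snd n)) j" for n :: "'s h1_identity" and j
    \<comment> \<open>Adding the indicator of \<open>\<pi> n j = v\<close> to the bit keeps columns injective. For \<open>t = True\<close> the identity
      \<open>n\<close> allows replacing \<open>\<pi>\<close> by \<open>\<sigma>\<close>; if \<open>\<pi> n j = v \<noteq> \<sigma> n j\<close> then both bits end up as \<open>True\<close>.\<close>
    define \<rho> where "\<rho> = (\<lambda>(n, v, t) j. (n, v, t \<noteq> (\<pi> n j = v)))"
    define \<rho>' where "\<rho>' = (\<lambda>(n, v, t) j. (n, v, t \<noteq> ((if t then \<sigma> n j else \<pi> n j) = v)))"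
    have ident: "fst (fst n) \<in> \<Sigma>" "fst (snd n) \<in> \<Sigma>" "length (snd (fst n)) = ar (fst (fst n))"
      "length (snd (snd n)) = ar (fst (snd n))" if "n \<in> E\<^sub>0" for n
      using wf[OF that] that by (auto simp: \<Sigma>_def)
    have c_lt: "c s j < ar s" if "s \<in> \<Sigma>" "j \<in> J" for s j using c that by blast
    have \<rho>A: "\<rho> i j \<in> A" "\<rho>' i j \<in> A" if "i \<in> A" for i j
      using that by (auto simp: A_def \<rho>_def \<rho>'_def)
    have rows: "inj_on (\<lambda>i. \<rho> i j) A \<and> (\<lambda>i. \<rho> i j) ` A \<subseteq> A \<and> (\<lambda>i. \<rho>' i j) ` A \<subset> A"
      if j: "j \<in> J" for j
    proof -
      have "\<exists>n\<in>E\<^sub>0. \<pi> n j \<noteq> \<sigma> n j"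
      proof (rule ccontr)
        assume a: "\<not> ?thesis"
        \<comment> \<open>Column \<open>j\<close> picks the coordinate \<open>c s j\<close> for each
          symbol; if it satisfied all of \<open>E\<^sub>0\<close>, projections would too. Outside
          \<Sigma> the value 0 is legitimate since arities are positive.\<close>
        let ?p = "\<lambda>s. if s \<in> \<Sigma> then c s j else 0"
        have p1: "snd (fst n) ! ?p (fst (fst n)) = snd (snd n) ! ?p (fst (snd n))" if "n \<in> E\<^sub>0" for n
          using a that ident[OF that] by (simp add: \<pi>_def \<sigma>_def)
        have p2: "?p s < ar s" if "s \<in> \<Omega>" for s
          using that c_lt j E by (auto simp: h1_identities_over_def Suc_le_eq)
        have p1': "\<forall>((f, xs), (g, ys))\<in>E\<^sub>0. xs ! ?p f = ys ! ?p g"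
          using p1 by (intro ballI) (simp add: split_beta)
        show False
          by (rule notE[OF no_p], rule exI[of _ ?p], rule conjI[OF ballI p1'], erule p2)
      qed
      then obtain n where n: "n \<in> E\<^sub>0" "\<pi> n j \<noteq> \<sigma> n j" by blast
      have "\<pi> n j \<in> set (snd (fst n))"
        using ident[OF n(1)] c_lt[OF _ j] by (simp add: \<pi>_def)
      then have "(n, \<pi> n j, False) \<in> A" using n(1) by (simp add: A_def)
      moreover have "(n, \<pi> n j, False) \<notin> (\<lambda>i. \<rho>' i j) ` A"
        using n(2) by (auto simp: \<rho>'_def split: if_splits)
      moreover have "inj_on (\<lambda>i. \<rho> i j) A" by (auto simp: inj_on_def \<rho>_def)
      ultimately show ?thesis using \<rho>A by blast
    qed
    have conj: "conj_on Q (\<lambda>d. F (\<lambda>j. e (\<rho> i j) d)) (\<lambda>d. F (\<lambda>j. e (\<rho>' i j) d))" if i: "i \<in> A" for i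
    proof -
      obtain n v t where i': "i = (n, v, t)" by (metis surj_pair)
      obtain f xs g ys where n': "n = ((f, xs), (g, ys))" by (metis surj_pair)
      have n: "n \<in> E\<^sub>0" and v: "v \<in> set xs" using i i' n' by (auto simp: A_def)
      have FC: "F (\<lambda>j. e (\<rho> i j) d) \<in> C" if "d \<in> Q" for d
        by (rule idx_ops_closed[OF F]) (intro Pi_I eC \<rho>A i that)
      show ?thesis
      proof (cases t)
        case False
        then have "\<rho>' i j = \<rho> i j" for j by (simp add: i' \<rho>_def \<rho>'_def)
        then show ?thesis using FC by (simp add: conj_on_refl Pi_iff)
      next
        case True
        \<comment> \<open>A valuation that separates \<open>v\<close> from all other variables:
          \<open>v\<close> gets the vertex with bit \<open>False\<close>, every other variable the
          one with bit \<open>True\<close>.\<close>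
        define \<xi> where "\<xi> d x = e (n, v, x \<noteq> v) d" for d x
        have \<xi>S: "\<xi> d x \<in> S" if "d \<in> Q" for d x
          unfolding S_def \<xi>_def
          by (rule UN_I[of "(n, v, x \<noteq> v)"], use n v n' in \<open>simp add: A_def\<close>, rule imageI, rule that)
        obtain \<alpha> where \<alpha>: "\<alpha> \<in> G" "\<forall>y\<in>{..<ar f} \<rightarrow>\<^sub>E S. F (\<lambda>j. y (c f j)) = \<alpha> (I f y)"
          using c ident(1)[OF n] n' by auto
        obtain \<beta> where \<beta>: "\<beta> \<in> G" "\<forall>y\<in>{..<ar g} \<rightarrow>\<^sub>E S. F (\<lambda>j. y (c g j)) = \<beta> (I g y)"
          using c ident(2)[OF n] n' by auto
        have fg: "f \<in> \<Sigma>" "g \<in> \<Sigma>" "length xs = ar f" "length ys = ar g" using ident[OF n] n' by auto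
        \<comment> \<open>The common value of both sides of identity \<open>n\<close> under
          \<open>\<xi> d\<close>. Both rows are conjugate to it, through the minors of
          \<open>F\<close> for \<open>f\<close> and for \<open>g\<close>.\<close>
        define w where "w d = I f (\<lambda>k\<in>{..<ar f}. \<xi> d (xs ! k))" for d
        have w: "w d = I g (\<lambda>k\<in>{..<ar g}. \<xi> d (ys ! k))" if d: "d \<in> Q" for d
        proof -
          have "\<xi> d \<in> UNIV \<rightarrow> C" using \<xi>S[OF d] SC by auto
          moreover have "((f, xs), (g, ys)) \<in> E" using n n' E\<^sub>0(1) by auto
          ultimately have "eval_h1_term I (\<xi> d) (f, xs) = eval_h1_term I (\<xi> d) (g, ys)"
            using I(2) by fast
          then show ?thesis using fg by (simp add: eval_h1_term_def w_def)
        qed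
        have wC: "w \<in> Q \<rightarrow> C"
        proof
          fix d assume d: "d \<in> Q"
          have "(ar f, I f) \<in> \<C>" using I(1) fg \<Sigma>(2) by auto
          from op_mem[OF this] restrict_tuples[of "ar f" "\<lambda>k. \<xi> d (xs ! k)"] \<xi>S[OF d] SC
          show "w d \<in> C" unfolding w_def by auto
        qed
        have "F (\<lambda>j. e (\<rho> i j) d) = \<alpha> (w d)" if d: "d \<in> Q" for d
        proof -
          have "F (\<lambda>j. e (\<rho> i j) d) = F (\<lambda>j. (\<lambda>k\<in>{..<ar f}. \<xi> d (xs ! k)) (c f j))"
          proof (rule idx_ops_eq[OF F])
            fix j assume "j \<in> J"
            then show "e (\<rho> i j) d = (\<lambda>k\<in>{..<ar f}. \<xi> d (xs ! k)) (c f j)"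
              using c_lt[OF fg(1)] True by (simp add: \<xi>_def \<rho>_def \<pi>_def i' n')
          qed (intro Pi_I eC \<rho>A i d)
          also have "\<dots> = \<alpha> (w d)"
            unfolding w_def by (rule \<alpha>(2)[rule_format]) (intro restrict_PiE_iff[THEN iffD2] ballI \<xi>S d)
          finally show ?thesis .
        qed
        then have 1: "conj_on Q w (\<lambda>d. F (\<lambda>j. e (\<rho> i j) d))"
          using \<alpha>(1) unfolding conj_on_def by blast
        have "F (\<lambda>j. e (\<rho>' i j) d) = \<beta> (w d)" if d: "d \<in> Q" for d
        proof -
          have "F (\<lambda>j. e (\<rho>' i j) d) = F (\<lambda>j. (\<lambda>k\<in>{..<ar g}. \<xi> d (ys ! k)) (c g j))"
          proof (rule idx_ops_eq[OF F])
            fix j assume "j \<in> J"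
            then show "e (\<rho>' i j) d = (\<lambda>k\<in>{..<ar g}. \<xi> d (ys ! k)) (c g j)"
              using c_lt[OF fg(2)] True by (simp add: \<xi>_def \<rho>'_def \<sigma>_def i' n')
          qed (intro Pi_I eC \<rho>A i d)
          also have "\<dots> = \<beta> (w d)"
            unfolding w[OF d] by (rule \<beta>(2)[rule_format]) (intro restrict_PiE_iff[THEN iffD2] ballI \<xi>S d)
          finally show ?thesis .
        qed
        then have 2: "conj_on Q w (\<lambda>d. F (\<lambda>j. e (\<rho>' i j) d))"
          using \<beta>(1) unfolding conj_on_def by blast
        show ?thesis by (rule conj_on_trans[OF _ conj_on_sym[OF wC 1] 2]) (use FC in auto)
      qed
    qed
    show "\<exists>(J :: nat set) F \<rho> \<rho>'. F \<in> idx_ops J \<and>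
        (\<forall>j\<in>J. inj_on (\<lambda>i. \<rho> i j) A \<and> (\<lambda>i. \<rho> i j) ` A \<subseteq> A \<and> (\<lambda>i. \<rho>' i j) ` A \<subset> A) \<and>
        (\<forall>i\<in>A. conj_on Q (\<lambda>d. F (\<lambda>j. e (\<rho> i j) d)) (\<lambda>d. F (\<lambda>j. e (\<rho>' i j) d)))"
      by (rule exI[of _ J], rule exI[of _ F], rule exI[of _ \<rho>], rule exI[of _ \<rho>'])
        (intro conjI[OF F conjI] ballI, erule rows, erule conj)
  qed
  moreover obtain h where "bij_betw h A {0..<card A}" using ex_bij_betw_finite_nat[OF A] by blast
  ultimately have "loop_cond {..<card A}"
    by (intro loop_cond_mono[of A h]) (auto simp: bij_betw_def)
  then show ?thesis by (intro loop_cond_4 loop_cond_6)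
qed

end

section \<open>From local to global\<close>

locale closed_core = oligomorphic_core +
  assumes countable: "countable C" and closed: "closed_clone C \<C>"
begin

text \<open>A basic neighbourhood of \<open>f\<close> restricts only finitely many values, so local
  approximation puts \<open>f\<close> into the closure of the members of arity
  \<open>n\<close>.\<close>

lemma closed_op_mem:
  assumes n: "1 \<le> n" and f: "f \<in> tuples n C \<rightarrow>\<^sub>E C"
    and approx: "\<And>T. finite T \<Longrightarrow> T \<subseteq> tuples n C \<Longrightarrow> \<exists>f'. (n, f') \<in> \<C> \<and> (\<forall>x\<in>T. f' x = f x)"
  shows "(n, f) \<in> \<C>"
proof -
  let ?X = "product_topology (\<lambda>_. discrete_topology C) (tuples n C)"
  have "closedin ?X {f. (n, f) \<in> \<C>}"
    using closed n
    by (auto simp: closed_clone_def operations_topology_def pointwise_topology_def closedin_sum_topology)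
  moreover have "f \<in> ?X closure_of {f. (n, f) \<in> \<C>}"
    unfolding in_closure_of
  proof (intro conjI allI impI)
    show "f \<in> topspace ?X" using f by simp
    fix T assume "f \<in> T \<and> openin ?X T"
    then obtain U where U: "finite {x \<in> tuples n C. U x \<noteq> C}" "f \<in> Pi\<^sub>E (tuples n C) U" "Pi\<^sub>E (tuples n C) U \<subseteq> T"
      unfolding openin_product_topology_alt by auto
    obtain f' where f': "(n, f') \<in> \<C>" "\<forall>x\<in>{x \<in> tuples n C. U x \<noteq> C}. f' x = f x"
      using approx[OF U(1)] by auto
    have "f' \<in> Pi\<^sub>E (tuples n C) U"
    proof (rule PiE_I)
      fix x assume x: "x \<in> tuples n C"
      show "f' x \<in> U x"
      proof (cases "U x = C")
        case True
        then show ?thesis using op_mem[OF f'(1)] x by auto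
      next
        case False
        then show ?thesis using f'(2) x U(2) by (auto simp: PiE_iff)
      qed
    qed (use op_mem[OF f'(1)] in auto)
    then show "\<exists>f'. f' \<in> {f. (n, f) \<in> \<C>} \<and> f' \<in> T" using U(3) f'(1) by blast
  qed
  ultimately show ?thesis by (simp add: closure_of_closedin)
qed

lemma closed_unary_mem:
  assumes u: "u \<in> C \<rightarrow>\<^sub>E C"
    and approx: "\<And>S. finite S \<Longrightarrow> S \<subseteq> C \<Longrightarrow> \<exists>u'\<in>unary_part C \<C>. \<forall>c\<in>S. u' c = u c"
  shows "u \<in> unary_part C \<C>"
proof -
  have t0: "x 0 \<in> C" if "x \<in> tuples 1 C" for x using that by (auto simp: tuples_def PiE_iff)
  have "(1, unary_op C u) \<in> \<C>"
  proof (rule closed_op_mem)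
    show "unary_op C u \<in> tuples 1 C \<rightarrow>\<^sub>E C" using u t0 by (auto simp: unary_op_def)
    fix T assume T: "finite T" "T \<subseteq> tuples 1 C"
    obtain u' where u': "u' \<in> unary_part C \<C>" "\<forall>c\<in>(\<lambda>x. x 0) ` T. u' c = u c"
      using approx[of "(\<lambda>x. x 0) ` T"] T t0 by auto
    then have "(1, unary_op C u') \<in> \<C>" "\<forall>x\<in>T. unary_op C u' x = unary_op C u x"
      using T(2) by (auto simp: unary_part_def unary_op_def)
    then show "\<exists>f'. (1, f') \<in> \<C> \<and> (\<forall>x\<in>T. f' x = unary_op C u x)" by blast
  qed simp
  then show ?thesis using u by (simp add: unary_part_def)
qed

section \<open>Compactness modulo the group\<close>

lemma limit_up_to_conj_nat:
  fixes x :: "nat \<Rightarrow> nat \<Rightarrow> 'a"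
  assumes x: "\<And>m k. x m k \<in> C"
  shows "\<exists>h. \<forall>n N. \<exists>m\<ge>N. conj_on {..<n} (x m) h"
proof -
  let ?P = "\<lambda>n h. infinite {m. conj_on {..<n} (x m) h}"
  \<comment> \<open>Longer and longer initial segments of the limit are fixed, each conjugate to the
    corresponding segments of infinitely many members of the sequence.\<close>
  have "\<exists>f. \<forall>n. ?P n (f n) \<and> (\<forall>k<n. f (Suc n) k = f n k)"
  proof (rule dependent_nat_choice)
    have "{m. conj_on {..<0} (x m) (x 0)} = UNIV"
      using G_id by (auto simp: conj_on_def)
    then show "\<exists>h. ?P 0 h" by (intro exI[of _ "x 0"]) simp
  next
    fix h n assume "?P n h"
    \<comment> \<open>There are finitely many orbits on one more coordinate, so infinitely many of
      the remaining members share the orbit of some \<open>x m\<^sub>0\<close>.\<close>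
    moreover have "finite ((\<lambda>m. orb {..<Suc n} (restrict (x m) {..<Suc n})) ` {m. conj_on {..<n} (x m) h})"
      by (rule finite_subset[OF _ finite_orbs[of "{..<Suc n}"]]) (use x in auto)
    ultimately obtain m\<^sub>0 where m\<^sub>0: "conj_on {..<n} (x m\<^sub>0) h"
      "infinite {m \<in> {m. conj_on {..<n} (x m) h}.
        orb {..<Suc n} (restrict (x m) {..<Suc n}) = orb {..<Suc n} (restrict (x m\<^sub>0) {..<Suc n})}"
      (is "infinite ?M")
      using pigeonhole_infinite[of "{m. conj_on {..<n} (x m) h}"] by auto
    \<comment> \<open>Moving \<open>x m\<^sub>0\<close> by \<eta> makes it agree with
      \<open>h\<close> on the first \<open>n\<close> coordinates, so the next segment extends the
      previous one.\<close>
    obtain \<eta> where \<eta>: "\<eta> \<in> G" "\<forall>k<n. h k = \<eta> (x m\<^sub>0 k)" using m\<^sub>0(1) by (auto simp: conj_on_def)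
    have "conj_on {..<Suc n} (x m) (\<lambda>k. \<eta> (x m\<^sub>0 k))" if "m \<in> ?M" for m
    proof -
      have "conj_on {..<Suc n} (restrict (x m) {..<Suc n}) (restrict (x m\<^sub>0) {..<Suc n})"
        using that x by (intro orb_eqD) auto
      then have "conj_on {..<Suc n} (x m) (x m\<^sub>0)" by (simp add: conj_on_def)
      moreover have "conj_on {..<Suc n} (x m\<^sub>0) (\<lambda>k. \<eta> (x m\<^sub>0 k))"
        using \<eta>(1) by (auto simp: conj_on_def)
      moreover have "x m \<in> {..<Suc n} \<rightarrow> C" using x by simp
      ultimately show ?thesis by (rule conj_on_trans[rotated])
    qed
    then have "?M \<subseteq> {m. conj_on {..<Suc n} (x m) (\<lambda>k. \<eta> (x m\<^sub>0 k))}" by blast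
    then have "?P (Suc n) (\<lambda>k. \<eta> (x m\<^sub>0 k))" using m\<^sub>0(2) infinite_super by blast
    then show "\<exists>h'. ?P (Suc n) h' \<and> (\<forall>k<n. h' k = h k)"
      using \<eta>(2) by (intro exI[of _ "\<lambda>k. \<eta> (x m\<^sub>0 k)"]) simp
  qed
  then obtain f where f: "\<And>n. ?P n (f n)" "\<And>n k. k < n \<Longrightarrow> f (Suc n) k = f n k" by blast
  have eq: "f n k = f (Suc k) k" if "k < n" for n k
    using that by (induction n) (auto simp: less_Suc_eq f(2))
  have "\<exists>m\<ge>N. conj_on {..<n} (x m) (\<lambda>k. f (Suc k) k)" for n N
  proof -
    have "\<exists>m\<ge>N. m \<in> {m. conj_on {..<n} (x m) (f n)}"
      using f(1)[of n] unfolding infinite_nat_iff_unbounded_le by (rule spec)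
    then obtain m \<alpha> where "m \<ge> N" "\<alpha> \<in> G" "\<forall>k\<in>{..<n}. f n k = \<alpha> (x m k)"
      by (auto simp: conj_on_def)
    moreover have "f (Suc k) k = \<alpha> (x m k)" if "k \<in> {..<n}" for k
      using calculation(3) eq[of k n] that by simp
    ultimately show ?thesis unfolding conj_on_def by blast
  qed
  then show ?thesis by (intro exI[of _ "\<lambda>k. f (Suc k) k"] allI)
qed

lemma limit_up_to_conj:
  fixes D :: "'d set" and g :: "nat \<Rightarrow> 'd \<Rightarrow> 'a"
  assumes D: "countable D" "D \<noteq> {}" and g: "\<And>m d. d \<in> D \<Longrightarrow> g m d \<in> C"
  shows "\<exists>h. \<forall>F N. finite F \<longrightarrow> F \<subseteq> D \<longrightarrow> (\<exists>m\<ge>N. conj_on F (g m) h)"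
proof -
  let ?e = "from_nat_into D"
  obtain h where h: "\<And>n N. \<exists>m\<ge>N. conj_on {..<n} (\<lambda>k. g m (?e k)) h"
    using limit_up_to_conj_nat[of "\<lambda>m k. g m (?e k)"] g from_nat_into[OF D(2)] by blast
  have "\<exists>m\<ge>N. conj_on F (g m) (\<lambda>d. h (to_nat_on D d))" if F: "finite F" "F \<subseteq> D" for F N
  proof -
    obtain n where n: "to_nat_on D ` F \<subseteq> {..<n}"
      using F(1) finite_nat_iff_bounded[of "to_nat_on D ` F"] by auto
    obtain m where m: "m \<ge> N" "conj_on {..<n} (\<lambda>k. g m (?e k)) h" using h by blast
    then obtain \<eta> where \<eta>: "\<eta> \<in> G" "\<forall>k<n. h k = \<eta> (g m (?e k))" by (auto simp: conj_on_def)
    have "h (to_nat_on D d) = \<eta> (g m d)" if "d \<in> F" for d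
    proof -
      have "?e (to_nat_on D d) = d" using that F(2) D(1) by auto
      moreover have "to_nat_on D d < n" using n that by auto
      ultimately show ?thesis using \<eta>(2) by metis
    qed
    then show ?thesis using m(1) \<eta>(1) unfolding conj_on_def by blast
  qed
  then show ?thesis by blast
qed

text \<open>Here the coordinates \<open>d\<close> are valuations of the four variables: the loop
  condition gives the desired identity on finitely many of them, up to one group element.\<close>

lemma loop_cond_K4:
  fixes s :: "nat \<Rightarrow> nat \<Rightarrow> 'a"
  assumes loop: "loop_cond {..<4::nat}" and Q: "finite Q"
    and s: "\<And>d v. d \<in> Q \<Longrightarrow> v \<in> {1,2,3,4} \<Longrightarrow> s d v \<in> C"
  shows "\<exists>f \<alpha>. (12, f) \<in> \<C> \<and> \<alpha> \<in> G \<and>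
    (\<forall>d\<in>Q. f (\<lambda>i\<in>{..<12}. s d (snd (K4_edges ! i))) = \<alpha> (f (\<lambda>i\<in>{..<12}. s d (fst (K4_edges ! i)))))"
proof -
  let ?V = "{1,2,3,4::nat}"
  have "loop_cond ?V"
    by (rule loop_cond_mono[OF loop, of Suc]) (auto simp: less_Suc_eq numeral_eq_Suc)
  from this[unfolded loop_cond_def, rule_format, of Q "\<lambda>v d. s d v"] Q s
  have "\<exists>F\<in>idx_ops (off_diag ?V). conj_on Q (\<lambda>d. F (\<lambda>p. s d (fst p))) (\<lambda>d. F (\<lambda>p. s d (snd p)))"
    by (simp add: Pi_iff)
  then obtain F where F: "F \<in> idx_ops (off_diag ?V)"
    and c: "conj_on Q (\<lambda>d. F (\<lambda>p. s d (fst p))) (\<lambda>d. F (\<lambda>p. s d (snd p)))" ..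
  have "set K4_edges = off_diag ?V"
    unfolding K4_edges_enumerates(3) off_diag_def by blast
  then have "bij_betw ((!) K4_edges) {..<12} (off_diag ?V)"
    using K4_edges_enumerates(1,2) bij_betw_nth by metis
  from idx_ops_bij[OF F this] obtain f where f': "(12, f) \<in> \<C> \<and>
    (\<forall>x\<in>off_diag ?V \<rightarrow> C. F x = f (\<lambda>i\<in>{..<12}. x (K4_edges ! i)))" ..
  note f = conjunct1[OF f'] conjunct2[OF f']
  have mem: "(\<lambda>p. s d (fst p)) \<in> off_diag ?V \<rightarrow> C" "(\<lambda>p. s d (snd p)) \<in> off_diag ?V \<rightarrow> C"
    if "d \<in> Q" for d
    by (rule Pi_I, rule s[OF that], simp only: off_diag_def mem_Collect_eq split_beta)+
  obtain \<alpha> where \<alpha>: "\<alpha> \<in> G" "\<forall>d\<in>Q. F (\<lambda>p. s d (snd p)) = \<alpha> (F (\<lambda>p. s d (fst p)))"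
    using c unfolding conj_on_def by blast
  show ?thesis
  proof (intro exI conjI ballI)
    fix d assume d: "d \<in> Q"
    show "f (\<lambda>i\<in>{..<12}. s d (snd (K4_edges ! i))) = \<alpha> (f (\<lambda>i\<in>{..<12}. s d (fst (K4_edges ! i))))"
      using \<alpha>(2) d f(2)[rule_format, OF mem(1)[OF d]] f(2)[rule_format, OF mem(2)[OF d]] by simp
  qed (fact f(1) \<alpha>(1))+
qed

text \<open>On every finite set of arguments the limit is some \<open>f m\<close> followed by a
  group element, hence a member of the clone; closedness does the rest.\<close>

lemma limit_op:
  fixes f :: "nat \<Rightarrow> 'a operation"
  assumes ne: "C \<noteq> {}" and n: "1 \<le> n" and f: "\<And>m. (n, f m) \<in> \<C>"
  shows "\<exists>f'. (n, f') \<in> \<C> \<and> (\<forall>T N. finite T \<longrightarrow> T \<subseteq> tuples n C \<longrightarrow> (\<exists>m\<ge>N. conj_on T (f m) f'))"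
proof -
  have "countable (tuples n C)" "tuples n C \<noteq> {}"
    unfolding tuples_def using countable ne by (auto intro!: countable_PiE simp: PiE_eq_empty_iff)
  moreover have "f m x \<in> C" if "x \<in> tuples n C" for m x using op_mem[OF f] that by auto
  ultimately obtain h where h: "\<And>T N. finite T \<Longrightarrow> T \<subseteq> tuples n C \<Longrightarrow> \<exists>m\<ge>N. conj_on T (f m) h"
    using limit_up_to_conj[of "tuples n C" f] by metis
  have h': "\<exists>m\<ge>N. conj_on T (f m) (restrict h (tuples n C))" if T: "finite T" "T \<subseteq> tuples n C" for T N
    using h[OF T, of N] T(2) unfolding conj_on_def by (metis restrict_apply' subset_iff)
  have approx: "\<exists>f'. (n, f') \<in> \<C> \<and> (\<forall>x\<in>T. f' x = restrict h (tuples n C) x)"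
    if T: "finite T" "T \<subseteq> tuples n C" for T
  proof -
    obtain m \<eta> where \<eta>: "\<eta> \<in> G" "\<forall>x\<in>T. restrict h (tuples n C) x = \<eta> (f m x)"
      using h'[OF T, of 0] unfolding conj_on_def by blast
    let ?f = "compose_op C 1 n (unary_op C \<eta>) (\<lambda>_. f m)"
    have "(n, ?f) \<in> \<C>"
      by (rule compose_mem[OF _ f]) (use G_unary[OF \<eta>(1)] in \<open>simp add: unary_part_def\<close>)
    moreover have "?f x = restrict h (tuples n C) x" if x: "x \<in> T" for x
    proof -
      have xt: "x \<in> tuples n C" using x T(2) by blast
      have "f m x \<in> C" using op_mem[OF f] xt by auto
      then have "(\<lambda>i\<in>{..<1}. f m x) \<in> tuples 1 C" by (intro restrict_tuples)
      then have "?f x = \<eta> (f m x)" using xt by (simp add: compose_op_def unary_op_def)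
      then show ?thesis using \<eta>(2) x by simp
    qed
    ultimately show ?thesis by blast
  qed
  have "restrict h (tuples n C) \<in> tuples n C \<rightarrow>\<^sub>E C"
  proof (rule restrict_PiE_iff[THEN iffD2], rule ballI)
    fix x assume x: "x \<in> tuples n C"
    obtain f' where "(n, f') \<in> \<C>" "f' x = h x" using approx[of "{x}"] x by auto
    then show "h x \<in> C" using op_mem[of n f'] x by (metis PiE_mem)
  qed
  then have "(n, restrict h (tuples n C)) \<in> \<C>" using approx by (rule closed_op_mem[OF n])
  then show ?thesis using h' by blast
qed

text \<open>A limit of permutations need not be onto \<open>C\<close>, so it is placed only in the
  unary part.\<close>

lemma limit_unary:
  assumes g: "\<And>n :: nat. \<gamma> n \<in> G"
    and h: "\<And>F N. finite F \<Longrightarrow> F \<subseteq> C \<Longrightarrow> \<exists>m\<ge>N. conj_on F (\<gamma> m) h"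
  shows "restrict h C \<in> unary_part C \<C>"
proof (rule closed_unary_mem)
  have ap: "\<exists>u'\<in>G. \<forall>c\<in>S. u' c = h c" if S: "finite S" "S \<subseteq> C" for S
  proof -
    obtain m \<eta> where \<eta>: "\<eta> \<in> G" "\<forall>c\<in>S. h c = \<eta> (\<gamma> m c)"
      using h[OF S, of 0] unfolding conj_on_def by blast
    obtain \<delta> where "\<delta> \<in> G" "\<forall>c\<in>C. \<delta> c = \<eta> (\<gamma> m c)" using G_comp[OF \<eta>(1) g] by blast
    then show ?thesis using \<eta>(2) S(2) by (metis subset_iff)
  qed
  show "\<exists>u'\<in>unary_part C \<C>. \<forall>c\<in>S. u' c = restrict h C c" if S: "finite S" "S \<subseteq> C" for S
    using ap[OF S] G_unary S(2) by (metis restrict_apply' subset_iff)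
  show "restrict h C \<in> C \<rightarrow>\<^sub>E C"
  proof (rule restrict_PiE_iff[THEN iffD2], rule ballI)
    fix c assume c: "c \<in> C"
    obtain u where "u \<in> G" "u c = h c" using ap[of "{c}"] c by auto
    then show "h c \<in> C" using G_closed[of u c] c by simp
  qed
qed

text \<open>Two limits are taken. The first merges the operations that work for finitely many
  valuations into one \<open>f\<close>; the second merges the pairs of group elements that equate
  the two sides of \<open>f\<close> on longer and longer lists of valuations.\<close>

lemma satisfies_pL24_if_loop_cond:
  assumes loop: "loop_cond {..<4::nat}"
  shows "satisfies_pL24 C \<C>"
proof (cases "C = {}")
  case True
  obtain u where "u \<in> G" using G_id by blast
  then have "u \<in> unary_part C \<C>" by (rule G_unary)
  moreover have "(12, projection C 12 0) \<in> \<C>" by (rule projection_mem) simp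
  ultimately show ?thesis unfolding satisfies_pL24_def using True by blast
next
  case False
  let ?V = "{1,2,3,4::nat}"
  define row where "row p \<sigma> = (\<lambda>i\<in>{..<12::nat}. \<sigma> (p (K4_edges ! i)))"
    for p :: "nat \<times> nat \<Rightarrow> nat" and \<sigma> :: "nat \<Rightarrow> 'a"
  have K: "fst (K4_edges ! i) \<in> ?V \<and> snd (K4_edges ! i) \<in> ?V" if "i < 12" for i
  proof -
    have "K4_edges ! i \<in> set K4_edges" using that K4_edges_enumerates(2) by (metis nth_mem)
    then show ?thesis unfolding K4_edges_enumerates(3) by auto
  qed
  \<comment> \<open>Only the four variables matter, so the valuations form a countable set and can
    be listed as \<open>s\<close>.\<close>
  define As where "As = ?V \<rightarrow>\<^sub>E C"
  have As: "countable As" "As \<noteq> {}"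
    unfolding As_def using countable False by (auto intro!: countable_PiE simp: PiE_eq_empty_iff)
  define s where "s = from_nat_into As"
  have s: "s d \<in> As" for d unfolding s_def by (rule from_nat_into[OF As(2)])
  have sC: "s d v \<in> C" if "v \<in> ?V" for d v using s[of d] that unfolding As_def by (rule PiE_mem)
  have s_onto: "\<exists>d. s d = \<sigma>" if "\<sigma> \<in> As" for \<sigma>
    unfolding s_def using from_nat_into_surj[OF As(1) that] by blast
  have row_s: "row fst (s d) \<in> tuples 12 C" "row snd (s d) \<in> tuples 12 C" for d
    unfolding row_def by (intro restrict_tuples sC, use K in blast)+
  have "\<forall>N. \<exists>p. (12, fst p) \<in> \<C> \<and> snd p \<in> G \<and>
      (\<forall>d<N. fst p (row snd (s d)) = snd p (fst p (row fst (s d))))"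
  proof
    fix N :: nat
    obtain f \<alpha> where "(12, f) \<in> \<C>" "\<alpha> \<in> G"
      "\<forall>d\<in>{..<N}. f (row snd (s d)) = \<alpha> (f (row fst (s d)))"
      using loop_cond_K4[OF loop, of "{..<N}" s] sC unfolding row_def by auto
    then show "\<exists>p. (12, fst p) \<in> \<C> \<and> snd p \<in> G \<and>
        (\<forall>d<N. fst p (row snd (s d)) = snd p (fst p (row fst (s d))))"
      by (intro exI[of _ "(f, \<alpha>)"]) simp
  qed
  from choice[OF this] obtain p where p: "\<forall>N. (12, fst (p N)) \<in> \<C> \<and> snd (p N) \<in> G \<and>
      (\<forall>d<N. fst (p N) (row snd (s d)) = snd (p N) (fst (p N) (row fst (s d))))" ..
  obtain f where f: "(12, f) \<in> \<C>"
    and f_lim: "\<And>T N. finite T \<Longrightarrow> T \<subseteq> tuples 12 C \<Longrightarrow> \<exists>m\<ge>N. conj_on T (fst (p m)) f"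
    using limit_op[OF False, of 12 "\<lambda>m. fst (p m)"] p by auto
  have fC: "f t \<in> C" if "t \<in> tuples 12 C" for t using op_mem[OF f] that by auto
  have "\<forall>n. \<exists>q. fst q \<in> G \<and> snd q \<in> G \<and>
      (\<forall>d<n. fst q (f (row fst (s d))) = snd q (f (row snd (s d))))"
  proof
    fix n :: nat
    let ?T = "(\<lambda>d. row fst (s d)) ` {..<n} \<union> (\<lambda>d. row snd (s d)) ` {..<n}"
    have T: "finite ?T" "?T \<subseteq> tuples 12 C" using row_s by auto
    obtain m where m: "m \<ge> n" "conj_on ?T (fst (p m)) f" using f_lim[OF T] by blast
    have "fst (p m) \<in> ?T \<rightarrow> C" using op_mem[of 12 "fst (p m)"] p T(2) by (auto simp: PiE_iff)
    from conj_on_sym[OF this m(2)] obtain \<epsilon> where \<epsilon>: "\<epsilon> \<in> G" "\<forall>t\<in>?T. fst (p m) t = \<epsilon> (f t)"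
      unfolding conj_on_def by blast
    \<comment> \<open>On the first \<open>n\<close> valuations \<open>fst (p m)\<close> is
      \<epsilon> after \<open>f\<close>; substituting this into the identity for
      \<open>fst (p m)\<close> puts \<delta> on one side and \<epsilon> on the other.\<close>
    obtain \<delta> where \<delta>: "\<delta> \<in> G" "\<forall>c\<in>C. \<delta> c = snd (p m) (\<epsilon> c)"
      using G_comp[of "snd (p m)" \<epsilon>] \<epsilon>(1) p by blast
    have "\<delta> (f (row fst (s d))) = \<epsilon> (f (row snd (s d)))" if d: "d < n" for d
    proof -
      have t: "row fst (s d) \<in> ?T" "row snd (s d) \<in> ?T" using d by blast+
      have "\<delta> (f (row fst (s d))) = snd (p m) (\<epsilon> (f (row fst (s d))))" using \<delta>(2) fC[OF row_s(1)] by blast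
      also have "\<dots> = snd (p m) (fst (p m) (row fst (s d)))" using \<epsilon>(2) t(1) by simp
      also have "\<dots> = fst (p m) (row snd (s d))" using p d m(1) by (metis order_less_le_trans)
      also have "\<dots> = \<epsilon> (f (row snd (s d)))" using \<epsilon>(2) t(2) by simp
      finally show ?thesis .
    qed
    then show "\<exists>q. fst q \<in> G \<and> snd q \<in> G \<and>
        (\<forall>d<n. fst q (f (row fst (s d))) = snd q (f (row snd (s d))))"
      using \<delta>(1) \<epsilon>(1) by (intro exI[of _ "(\<delta>, \<epsilon>)"]) simp
  qed
  from choice[OF this] obtain q where q: "\<forall>n. fst (q n) \<in> G \<and> snd (q n) \<in> G \<and>
      (\<forall>d<n. fst (q n) (f (row fst (s d))) = snd (q n) (f (row snd (s d))))" ..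
  \<comment> \<open>Each pair is coded as one function on \<open>C \<times> UNIV\<close>, so that in
    the limit both components are moved by the same group element and their equation
    survives.\<close>
  let ?g = "\<lambda>n (c, b). if b then fst (q n) c else snd (q n) c"
  have "countable (C \<times> (UNIV :: bool set))" "C \<times> (UNIV :: bool set) \<noteq> {}"
    using countable False by auto
  moreover have "?g m d \<in> C" if "d \<in> C \<times> (UNIV :: bool set)" for m d
    using that q G_closed by (auto split: prod.splits)
  ultimately have "\<exists>h. \<forall>F N. finite F \<longrightarrow> F \<subseteq> C \<times> UNIV \<longrightarrow> (\<exists>m\<ge>N. conj_on F (?g m) h)"
    by (rule limit_up_to_conj)
  then obtain h where h: "\<And>F N. finite F \<Longrightarrow> F \<subseteq> C \<times> UNIV \<Longrightarrow> \<exists>m\<ge>N. conj_on F (?g m) h"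
    by blast
  have u: "(\<lambda>c\<in>C. h (c, b)) \<in> unary_part C \<C>" for b
  proof (rule limit_unary)
    show "(if b then fst (q n) else snd (q n)) \<in> G" for n using q by simp
    fix F N assume F: "finite F" "F \<subseteq> C"
    obtain m \<eta> where "m \<ge> N" "\<eta> \<in> G" "\<forall>d\<in>F \<times> {b}. h d = \<eta> (?g m d)"
      using h[of "F \<times> {b}" N] F unfolding conj_on_def by auto
    then show "\<exists>m\<ge>N. conj_on F (if b then fst (q m) else snd (q m)) (\<lambda>c. h (c, b))"
      unfolding conj_on_def by (intro exI[of _ m] conjI bexI[of _ \<eta>]) auto
  qed
  have "(\<lambda>c\<in>C. h (c, True)) (f (row fst \<sigma>)) = (\<lambda>c\<in>C. h (c, False)) (f (row snd \<sigma>))"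
    if \<sigma>: "\<sigma> \<in> UNIV \<rightarrow> C" for \<sigma>
  proof -
    have "restrict \<sigma> ?V \<in> As" using \<sigma> by (auto simp: As_def)
    then obtain d where d: "s d = restrict \<sigma> ?V" using s_onto by blast
    have rows: "row fst (s d) = row fst \<sigma>" "row snd (s d) = row snd \<sigma>"
      unfolding d row_def by (intro restrict_ext, use K in auto)+
    let ?y = "f (row fst \<sigma>)" and ?y' = "f (row snd \<sigma>)"
    have y: "?y \<in> C" "?y' \<in> C" using fC row_s[of d] rows by auto
    \<comment> \<open>The bound \<open>Suc d\<close> ensures that valuation \<open>d\<close> is
      among those for which the pair \<open>q m\<close> equates the two sides.\<close>
    obtain m \<eta> where m: "m \<ge> Suc d" "\<eta> \<in> G" "\<forall>d\<in>{(?y, True), (?y', False)}. h d = \<eta> (?g m d)"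
      using h[of "{(?y, True), (?y', False)}" "Suc d"] y unfolding conj_on_def by auto
    have "fst (q m) ?y = snd (q m) ?y'" using q m(1) rows by (metis Suc_le_lessD)
    then have "h (?y, True) = h (?y', False)" using m(3) by simp
    then show ?thesis using y by simp
  qed
  then show ?thesis
    unfolding satisfies_pL24_def row_def using u f by blast
qed

end

theorem theorem4p9:
  fixes C :: "'a set" and \<C> :: "(nat \<times> 'a operation) set"
    and \<Omega> :: "'s set" and ar :: "'s \<Rightarrow> nat" and E :: "'s h1_identity set"
  assumes "countable C"
    and "function_clone C \<C>"
    and "closed_clone C \<C>"
    and "oligomorphic C \<C>"
    and "core_clone C \<C>"
    and "h1_identities_over \<Omega> ar E"
    and "non_trivial_h1 \<Omega> ar E"
    and "satisfies_h1 C \<C> \<Omega> ar E"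
  shows "satisfies_pL24 C \<C>"
proof -
  interpret closed_core C \<C> by unfold_locales (fact assms)+
  show ?thesis using assms(6-8) by (intro satisfies_pL24_if_loop_cond loop_cond_4_if_non_trivial_h1)
qed

end
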